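(* Let $\mathcal{F},\mathcal{G}$ be regular thin families with $o(\mathcal{F})<o(\mathcal{G})$ and let $M\in[\mathbb{N}]^\infty$. Then there is no plegma preserving map from $\mathcal{F}\upharpoonright M$ to $\mathcal{G}$. More precisely, for every $M\in[\mathbb{N}]^\infty$ and every $\varphi:\mathcal{F}\upharpoonright M\to\mathcal{G}$ there exists $L\in[M]^\infty$ such that for every plegma pair $(s_1,s_2)$ in $\mathcal{F}\upharpoonright L$ neither $(\varphi(s_1),\varphi(s_2))$ nor $(\varphi(s_2),\varphi(s_1))$ is a plegma pair.
   Context: $\mathbb{N}=\{1,2,\dots\}$. For $M\subseteq\mathbb{N}$, $[M]^{<\infty}$ and $[M]^\infty$ denote the sets of finite, respectively infinite, subsets of $M$. For $s\subseteq\mathbb{N}$, $s(k)$ is the $k$-th element of $s$ in increasing order and $|s|$ its cardinality. $t\sqsubseteq s$ (resp. $t\sqsubset s$) means that $t$ is an initial (resp. proper initial) segment of $s$. For $\mathcal{F}\subseteq[\mathbb{N}]^{<\infty}$, $\mathcal{F}\upharpoonright M=\mathcal{F}\cap[M]^{<\infty}$ and $\widehat{\mathcal{F}}=\{t\in[\mathbb{N}]^{<\infty}:\exists s\in\mathcal{F},\ t\sqsubseteq s\}$. A family $\mathcal{R}\subseteq[\mathbb{N}]^{<\infty}$ is regular if it is hereditary (closed under subsets), spreading (if $\{n_1<\dots<n_k\}\in\mathcal{R}$, $m_1<\dots<m_k$ and $n_i\leq m_i$ for all $i$, then $\{m_1,\dots,m_k\}\in\mathcal{R}$) and compact (the set of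 characteristic functions of its members is closed in $\{0,1\}^{\mathbb{N}}$). $\mathcal{F}$ is thin if no element of $\mathcal{F}$ is a proper initial segment of another one. $\mathcal{F}$ is regular thin if it is thin and $\widehat{\mathcal{F}}$ is regular. The order $o(\mathcal{F})$ of a nonempty family: if $\widehat{\mathcal{F}}$ contains an infinite $\sqsubset$-increasing sequence, $o(\mathcal{F})=\omega_1$; otherwise put $o_{\widehat{\mathcal{F}}}(s)=0$ for $\sqsubseteq$-maximal $s\in\widehat{\mathcal{F}}$, recursively $o_{\widehat{\mathcal{F}}}(s)=\sup\{o_{\widehat{\mathcal{F}}}(t)+1:t\in\widehat{\mathcal{F}},\ s\sqsubset t\}$, and $o(\mathcal{F})=o_{\widehat{\mathcal{F}}}(\varnothing)$. A pair $(s_1,s_2)$ of nonempty finite subsets of $\mathbb{N}$ is a plegma pair if $s_1(k)<s_2(k)$ for all $k\leq\min(|s_1|,|s_2|)$, and for all $i,j\in\{1,2\}$, $s_i(k)<s_j(k+1)$ whenever $k\leq\min(|s_i|,|s_j|-1)$. A map $\varphi$ from a family $\mathcal{H}\subseteq[\mathbb{N}]^{<\infty}$ to $[\mathbb{N}]^{<\infty}$ is plegma preserving if $(\varphi(s_1),\varphi(s_2))$ is a plegma pair whenever $(s_1,s_2)$ is a plegma pair of elements of $\mathcal{H}$.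
   Formalization: The first sentence (no plegma preserving map) is stated only for F ≠ {∅}: if F = {∅}, there are no plegma pairs of nonempty sets in F, so every map is vacuously plegma preserving. The "more precise" part is stated without this restriction. *)

theory Defs
  imports "HOL-Analysis.Analysis"
begin

section \<open>Ordinals\<close>

text \<open>Ordinals are isomorphism classes of well-orders whose field is a set of sets of naturals.
  These are all ordinals of cardinality at most the continuum; in particular \<open>\<omega>\<^sub>1\<close> occurs
  among them, and every countable set of them is bounded
  (lemma \<open>countable_ordinals_bdd_above\<close> below).\<close>

quotient_type ordinal = "nat set rel" / partial: "\<lambda>r s. (r, s) \<in> ordIso"
proof (rule part_equivpI)
  show "\<exists>r :: nat set rel. (r, r) \<in> ordIso"
    using ordIso_reflexive[OF card_of_Well_order] by blast
  show "symp (\<lambda>r s :: nat set rel. (r, s) \<in> ordIso)"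
    by (rule sympI) (rule ordIso_symmetric)
  show "transp (\<lambda>r s :: nat set rel. (r, s) \<in> ordIso)"
    by (rule transpI) (rule ordIso_transitive)
qed

lemma ordIso_imp_Well_order: "(r, s) \<in> ordIso \<Longrightarrow> Well_order r \<and> Well_order s"
  by (simp add: ordIso_def)

lemma Well_order_rep_ordinal: "Well_order (rep_ordinal a)"
  using Quotient3_rep_reflp[OF Quotient3_ordinal, of a] ordIso_imp_Well_order by blast

instantiation ordinal :: linorder
begin

lift_definition less_eq_ordinal :: "ordinal \<Rightarrow> ordinal \<Rightarrow> bool" is "\<lambda>r s. (r, s) \<in> ordLeq"
  by (meson ordIso_ordLeq_trans ordIso_symmetric ordLeq_ordIso_trans)

lift_definition less_ordinal :: "ordinal \<Rightarrow> ordinal \<Rightarrow> bool" is "\<lambda>r s. (r, s) \<in> ordLess"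
  by (meson ordIso_ordLess_trans ordIso_symmetric ordLess_ordIso_trans)

instance
proof
  fix a b c :: ordinal
  show "a < b \<longleftrightarrow> a \<le> b \<and> \<not> b \<le> a"
    by transfer (metis not_ordLess_ordLeq ordIso_imp_Well_order not_ordLeq_iff_ordLess
        ordLess_imp_ordLeq)
  show "a \<le> a"
    by transfer (metis ordIso_imp_Well_order ordLeq_reflexive)
  show "a \<le> b \<Longrightarrow> b \<le> c \<Longrightarrow> a \<le> c"
    by transfer (rule ordLeq_transitive)
  show "a \<le> b \<Longrightarrow> b \<le> a \<Longrightarrow> a = b"
    by transfer (simp add: ordIso_iff_ordLeq)
  show "a \<le> b \<or> b \<le> a"
    by transfer (metis ordIso_imp_Well_order ordLeq_total)
qed

end

lemma less_ordinal_rep: "a < b \<longleftrightarrow> (rep_ordinal a, rep_ordinal b) \<in> ordLess"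
  by (simp add: less_ordinal.rep_eq)

instance ordinal :: wellorder
proof
  fix P and a :: ordinal
  assume step: "\<And>a :: ordinal. (\<And>b. b < a \<Longrightarrow> P b) \<Longrightarrow> P a"
  have "wf (inv_image ordLess rep_ordinal)"
    by (intro wf_inv_image wf_ordLess)
  then show "P a"
  proof (induction a rule: wf_induct_rule)
    case (less a)
    then show ?case
      using step by (simp add: less_ordinal_rep)
  qed
qed

instantiation ordinal :: order_bot
begin

definition bot_ordinal :: ordinal where
  "bot_ordinal = (LEAST a. True)"

instance
  by standard (simp add: bot_ordinal_def Least_le)

end

instantiation ordinal :: conditionally_complete_linorder
begin

definition sup_ordinal :: "ordinal \<Rightarrow> ordinal \<Rightarrow> ordinal" where
  "sup_ordinal = max"

definition inf_ordinal :: "ordinal \<Rightarrow> ordinal \<Rightarrow> ordinal" where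
  "inf_ordinal = min"

definition Sup_ordinal :: "ordinal set \<Rightarrow> ordinal" where
  "Sup_ordinal A = (LEAST b. \<forall>a\<in>A. a \<le> b)"

definition Inf_ordinal :: "ordinal set \<Rightarrow> ordinal" where
  "Inf_ordinal A = (LEAST a. a \<in> A)"

instance
proof
  fix x y z :: ordinal and X :: "ordinal set"
  show "x \<in> X \<Longrightarrow> bdd_below X \<Longrightarrow> Inf X \<le> x"
    by (simp add: Inf_ordinal_def Least_le)
  show "X \<noteq> {} \<Longrightarrow> (\<And>x. x \<in> X \<Longrightarrow> z \<le> x) \<Longrightarrow> z \<le> Inf X"
    unfolding Inf_ordinal_def by (metis LeastI ex_in_conv)
  show "x \<le> Sup X" if x: "x \<in> X" and X: "bdd_above X"
  proof -
    obtain b where "\<forall>a\<in>X. a \<le> b"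
      using X by (auto simp: bdd_above_def)
    then have "\<forall>a\<in>X. a \<le> Sup X"
      unfolding Sup_ordinal_def by (rule LeastI)
    then show ?thesis
      using x by blast
  qed
  show "X \<noteq> {} \<Longrightarrow> (\<And>x. x \<in> X \<Longrightarrow> x \<le> z) \<Longrightarrow> Sup X \<le> z"
    unfolding Sup_ordinal_def by (auto intro: Least_le)
qed (auto simp: sup_ordinal_def inf_ordinal_def)

end

lemma Sup_ordinal_empty: "Sup ({} :: ordinal set) = bot"
  by (simp add: Sup_ordinal_def bot_ordinal_def)

definition ord_suc :: "ordinal \<Rightarrow> ordinal" where
  "ord_suc a = (LEAST b. a < b)"

lift_definition omega1 :: ordinal ("\<omega>\<^sub>1") is "cardSuc natLeq"
  by (simp add: cardSuc_Card_order natLeq_Card_order card_order_on_well_order_on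
      ordIso_reflexive)


lemma Restr_underS_ordLess:
  assumes r: "Well_order r" and xy: "(x, y) \<in> r" "x \<noteq> y"
  shows "(Restr r (underS r x), Restr r (underS r y)) \<in> ordLess"
proof -
  let ?U = "Restr r (underS r y)"
  have x: "x \<in> underS r y"
    using xy by (simp add: underS_def)
  have tr: "trans r" and re: "Refl r" and an: "antisym r"
    using r by (auto simp: well_order_on_def linear_order_on_def partial_order_on_def preorder_on_def)
  have "(x, x) \<in> r"
    using re xy by (auto simp: refl_on_def Field_def)
  then have "x \<in> Field ?U"
    using x by (auto simp: Field_def)
  moreover have sub: "underS r x \<subseteq> underS r y"
    using tr an xy unfolding underS_def by (auto dest: transD antisymD)
  have "Restr ?U (underS ?U x) = Restr r (underS r x)"
    using sub x by (auto simp: underS_def)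
  moreover have "Well_order ?U"
    using r by (rule Well_order_Restr)
  ultimately show ?thesis
    using underS_Restr_ordLess[of ?U x] by auto
qed

lemma rep_abs_ordinal: "Well_order r \<Longrightarrow> (rep_ordinal (abs_ordinal r), r) \<in> ordIso"
  by (metis Quotient3_ordinal Quotient3_rep_abs ordIso_reflexive)

text \<open>Every ordinal is the order type of the set of its predecessors.\<close>

lemma rep_ordinal_iso_lessThan:
  "(rep_ordinal a, {(b, c). b \<le> c \<and> c < a}) \<in> ordIso"
proof -
  let ?r = "rep_ordinal a"
  define f where "f x = abs_ordinal (Restr ?r (underS ?r x))" for x
  have r: "Well_order ?r"
    by (rule Well_order_rep_ordinal)
  have rep_f: "(rep_ordinal (f x), Restr ?r (underS ?r x)) \<in> ordIso" for x
    unfolding f_def by (intro rep_abs_ordinal Well_order_Restr r)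
  have mono: "f x < f y" if "(x, y) \<in> ?r" "x \<noteq> y" for x y
    using Restr_underS_ordLess[OF r that] rep_f[of x] rep_f[of y] unfolding less_ordinal_rep
    by (meson ordIso_ordLess_trans ordIso_symmetric ordLess_ordIso_trans)
  have tot: "(x, y) \<in> ?r \<or> (y, x) \<in> ?r" if "x \<in> Field ?r" "y \<in> Field ?r" for x y
    using r that
    by (metis linear_order_on_def partial_order_on_def preorder_on_def refl_on_def total_on_def
        well_order_on_def)
  have inj: "inj_on f (Field ?r)"
    using mono tot by (metis inj_onI less_irrefl)
  have less_iff: "b < a \<longleftrightarrow> (\<exists>x\<in>Field ?r. b = f x)" for b
  proof -
    have "b < a \<longleftrightarrow> (\<exists>x\<in>Field ?r. (rep_ordinal b, Restr ?r (underS ?r x)) \<in> ordIso)"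
      unfolding less_ordinal_rep
      by (intro ordLess_iff_ordIso_Restr r Well_order_rep_ordinal)
    also have "\<dots> \<longleftrightarrow> (\<exists>x\<in>Field ?r. (rep_ordinal b, rep_ordinal (f x)) \<in> ordIso)"
      using rep_f by (meson ordIso_symmetric ordIso_transitive)
    also have "\<dots> \<longleftrightarrow> (\<exists>x\<in>Field ?r. b = f x)"
      using Quotient3_rel_rep[OF Quotient3_ordinal] by auto
    finally show ?thesis .
  qed
  have "dir_image ?r f = {(b, c). b \<le> c \<and> c < a}"
  proof (intro equalityI subsetI)
    fix p assume "p \<in> dir_image ?r f"
    then obtain x y where p: "p = (f x, f y)" and xy: "(x, y) \<in> ?r"
      by (auto simp: dir_image_def)
    then have "y \<in> Field ?r"
      by (auto simp: Field_def)
    then show "p \<in> {(b, c). b \<le> c \<and> c < a}"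
      using p xy mono less_iff by (cases "x = y") (auto simp: less_imp_le)
  next
    fix p assume "p \<in> {(b, c). b \<le> c \<and> c < a}"
    then obtain b c where p: "p = (b, c)" and bc: "b \<le> c" "c < a"
      by auto
    have "b < a"
      using bc by (rule le_less_trans)
    then obtain x where x: "x \<in> Field ?r" "b = f x"
      unfolding less_iff by (elim bexE)
    obtain y where y: "y \<in> Field ?r" "c = f y"
      using bc(2) unfolding less_iff by (elim bexE)
    have "(x, y) \<in> ?r"
    proof (cases "(y, x) \<in> ?r \<and> y \<noteq> x")
      case True
      then show ?thesis
        using mono[of y x] bc(1) x(2) y(2) by simp
    next
      case False
      then show ?thesis
        using tot[OF x(1) y(1)] by (cases "x = y") auto
    qed
    then show "p \<in> dir_image ?r f"
      using p x y by (auto simp: dir_image_def)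
  qed
  then show ?thesis
    using dir_image_ordIso[OF r inj] by simp
qed

lemma card_of_lessThan_ordinal:
  "(card_of {..<a}, card_of (Field (rep_ordinal a))) \<in> ordIso"
proof -
  have "Field {(b, c). b \<le> c \<and> c < a} = {..<a :: ordinal}"
    by (auto simp: Field_def)
  then show ?thesis
    using ordIso_symmetric[OF card_of_cong[OF rep_ordinal_iso_lessThan[of a]]] by simp
qed

lemma countable_ordinals_bdd_above:
  fixes A :: "ordinal set"
  assumes "countable A"
  shows "\<exists>b. \<forall>a\<in>A. a < b"
proof (rule ccontr)
  assume "\<not> ?thesis"
  then have U: "UNIV = (\<Union>a\<in>A. insert a {..<a})"
    by (auto simp: not_less le_less)
  let ?C = "UNIV :: nat set set"
  have inf: "infinite ?C"
    by (simp add: Finite_Set.finite_set)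
  have segment: "(card_of {..<a}, card_of ?C) \<in> ordLeq" for a :: ordinal
    using card_of_lessThan_ordinal[of a] card_of_mono1[OF subset_UNIV]
    by (rule ordIso_ordLeq_trans)
  have "(card_of (insert a {..<a}), card_of ?C) \<in> ordLeq" for a :: ordinal
  proof -
    have "(card_of {a}, card_of ?C) \<in> ordLeq"
      by (simp add: card_of_singl_ordLeq)
    then show ?thesis
      using card_of_Un_ordLeq_infinite_Field[OF _ _ segment[of a], of "{a}"] inf
      by (metis Field_card_of card_of_Card_order insert_is_Un)
  qed
  moreover have "(card_of A, card_of ?C) \<in> ordLeq"
  proof -
    obtain g :: "ordinal \<Rightarrow> nat" where "inj_on g A"
      using assms by (auto simp: countable_def)
    then have "inj_on (\<lambda>a. {g a}) A"
      by (auto simp: inj_on_def)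
    then show ?thesis
      using card_of_ordLeq[of A ?C] by blast
  qed
  ultimately have "(card_of (\<Union>a\<in>A. insert a {..<a}), card_of ?C) \<in> ordLeq"
    by (intro card_of_UNION_ordLeq_infinite[OF inf]) auto
  then have "(card_of (UNIV :: ordinal set), card_of ?C) \<in> ordLeq"
    using U by simp
  then obtain f :: "ordinal \<Rightarrow> nat set" where f: "inj f"
    using card_of_ordLeq[of "UNIV :: ordinal set" ?C] by blast
  define W where "W = {(b, c :: ordinal). b \<le> c}"
  have F: "Field W = UNIV"
    by (auto simp: W_def Field_def)
  have "W - Id = {(b, c). b < c}"
    by (auto simp: W_def)
  then have "wf (W - Id)"
    by (simp add: wf)
  moreover have "linear_order W"
    unfolding linear_order_on_def partial_order_on_def preorder_on_def
    by (auto simp: refl_on_def trans_def antisym_def total_on_def W_def)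
  ultimately have W: "Well_order W"
    by (simp add: well_order_on_def F)
  define a where "a = abs_ordinal (dir_image W f)"
  have "(W, dir_image W f) \<in> ordIso"
    using W f F by (simp add: dir_image_ordIso)
  moreover have "(rep_ordinal a, dir_image W f) \<in> ordIso"
    unfolding a_def using W f F by (simp add: rep_abs_ordinal Well_order_dir_image)
  ultimately have "(W, {(b, c). b \<le> c \<and> c < a}) \<in> ordIso"
    using rep_ordinal_iso_lessThan[of a] by (meson ordIso_symmetric ordIso_transitive)
  moreover have "{(b, c). b \<le> c \<and> c < a} = Restr W (underS W a)"
    by (auto simp: W_def underS_def)
  moreover have "(Restr W (underS W a), W) \<in> ordLess"
    using W F by (simp add: underS_Restr_ordLess)
  ultimately show False
    using not_ordLess_ordIso ordIso_symmetric by fastforce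
qed

lemma less_omega1_iff: "a < \<omega>\<^sub>1 \<longleftrightarrow> countable {..<a}"
proof -
  let ?r = "rep_ordinal a" and ?w = "cardSuc natLeq"
  have r: "Well_order ?r"
    by (rule Well_order_rep_ordinal)
  have w: "Card_order ?w" "Well_order ?w"
    by (simp_all add: cardSuc_Card_order natLeq_Card_order cardSuc_Well_order)
  have "a < \<omega>\<^sub>1 \<longleftrightarrow> (?r, ?w) \<in> ordLess"
    using rep_abs_ordinal[OF w(2)] unfolding less_ordinal_rep omega1_def map_fun_apply id_apply
    by (meson ordIso_symmetric ordLess_ordIso_trans)
  also have "\<dots> \<longleftrightarrow> (card_of (Field ?r), natLeq) \<in> ordLeq"
  proof
    assume "(?r, ?w) \<in> ordLess"
    then have "(card_of (Field ?r), ?w) \<in> ordLess"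
      using r by (meson card_of_least ordLeq_ordLess_trans well_order_on_Field)
    then show "(card_of (Field ?r), natLeq) \<in> ordLeq"
      by (simp add: cardSuc_ordLeq_ordLess natLeq_Card_order card_of_Card_order)
  next
    assume *: "(card_of (Field ?r), natLeq) \<in> ordLeq"
    show "(?r, ?w) \<in> ordLess"
    proof (rule ccontr)
      assume "(?r, ?w) \<notin> ordLess"
      then have "(?w, ?r) \<in> ordLeq"
        using r w(2) not_ordLess_iff_ordLeq by blast
      then have "(card_of (Field ?w), card_of (Field ?r)) \<in> ordLeq"
        by (rule card_of_mono2)
      then have "(?w, natLeq) \<in> ordLeq"
        using * card_of_Field_ordIso[OF w(1)]
        by (meson ordIso_ordLeq_trans ordIso_symmetric ordLeq_transitive)
      then show False
        using cardSuc_greater[OF natLeq_Card_order] not_ordLess_ordLeq by blast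
    qed
  qed
  also have "\<dots> \<longleftrightarrow> (card_of {..<a}, natLeq) \<in> ordLeq"
    using card_of_lessThan_ordinal by (meson ordIso_ordLeq_trans ordIso_symmetric)
  also have "\<dots> \<longleftrightarrow> (card_of {..<a}, card_of (UNIV :: nat set)) \<in> ordLeq"
    using card_of_nat by (meson ordIso_symmetric ordLeq_ordIso_trans)
  also have "\<dots> \<longleftrightarrow> countable {..<a}"
    by (auto simp flip: card_of_ordLeq simp: countable_def)
  finally show ?thesis .
qed

lemma less_ord_suc: "a < ord_suc a"
  unfolding ord_suc_def using countable_ordinals_bdd_above[of "{a}"] by (auto intro: LeastI)

lemma ord_suc_le_iff: "ord_suc a \<le> b \<longleftrightarrow> a < b"
  using less_ord_suc[of a] by (auto simp: ord_suc_def intro: Least_le less_le_trans)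


section \<open>Families of finite sets of positive integers\<close>

abbreviation Npos :: "nat set" ("\<nat>\<^sub>+") where
  "\<nat>\<^sub>+ \<equiv> {1..}"

text \<open>\<open>elt s k\<close> is \<open>s(k)\<close>, counted from \<open>k = 1\<close>; only meaningful for \<open>1 \<le> k\<close> and,
  if \<open>s\<close> is finite, \<open>k \<le> card s\<close>.\<close>

definition elt :: "nat set \<Rightarrow> nat \<Rightarrow> nat" where
  "elt s k = enumerate s (k - 1)"

definition initial_seg :: "nat set \<Rightarrow> nat set \<Rightarrow> bool" (infix "\<sqsubseteq>\<^sub>i" 50) where
  "t \<sqsubseteq>\<^sub>i s \<longleftrightarrow> t \<subseteq> s \<and> (\<forall>m\<in>t. \<forall>n\<in>s - t. m < n)"

definition proper_initial_seg :: "nat set \<Rightarrow> nat set \<Rightarrow> bool" (infix "\<sqsubset>\<^sub>i" 50) where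
  "t \<sqsubset>\<^sub>i s \<longleftrightarrow> t \<sqsubseteq>\<^sub>i s \<and> t \<noteq> s"

definition restr_family :: "nat set set \<Rightarrow> nat set \<Rightarrow> nat set set" (infixl "\<restriction>\<^sub>f" 70) where
  "F \<restriction>\<^sub>f M = F \<inter> Fpow M"

definition hat :: "nat set set \<Rightarrow> nat set set" where
  "hat F = {t \<in> Fpow \<nat>\<^sub>+. \<exists>s\<in>F. t \<sqsubseteq>\<^sub>i s}"

definition hereditary :: "nat set set \<Rightarrow> bool" where
  "hereditary R \<longleftrightarrow> (\<forall>s\<in>R. \<forall>t. t \<subseteq> s \<longrightarrow> t \<in> R)"

definition spreading :: "nat set set \<Rightarrow> bool" where
  "spreading R \<longleftrightarrow>
    (\<forall>s\<in>R. \<forall>t\<in>Fpow \<nat>\<^sub>+. card t = card s \<and> (\<forall>i\<in>{1..card s}. elt s i \<le> elt t i) \<longrightarrow> t \<in> R)"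

definition compact_family :: "nat set set \<Rightarrow> bool" where
  "compact_family R \<longleftrightarrow>
    closedin (product_topology (\<lambda>_. discrete_topology {0, 1 :: nat}) \<nat>\<^sub>+)
      ((\<lambda>s. restrict (indicator s) \<nat>\<^sub>+) ` R)"

definition regular_family :: "nat set set \<Rightarrow> bool" where
  "regular_family R \<longleftrightarrow>
    R \<subseteq> Fpow \<nat>\<^sub>+ \<and> hereditary R \<and> spreading R \<and> compact_family R"

definition thin :: "nat set set \<Rightarrow> bool" where
  "thin F \<longleftrightarrow> (\<forall>s\<in>F. \<forall>t\<in>F. \<not> s \<sqsubset>\<^sub>i t)"

definition regular_thin :: "nat set set \<Rightarrow> bool" where
  "regular_thin F \<longleftrightarrow> F \<subseteq> Fpow \<nat>\<^sub>+ \<and> thin F \<and> regular_family (hat F)"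


section \<open>The order of a family\<close>

text \<open>\<open>node_order T s\<close> is \<open>o\<^sub>T(s)\<close>, the recursion along \<open>\<sqsubset>\<^sub>i\<close> on \<open>T\<close>. It is only meaningful
  if \<open>T\<close> has no infinite strictly increasing sequence; lemma \<open>node_order_rec\<close> below
  gives the recursion equation in that case. For maximal \<open>s\<close> the supremum is over the empty
  set, so the value is zero (lemma \<open>Sup_ordinal_empty\<close>).\<close>

definition node_order :: "nat set set \<Rightarrow> nat set \<Rightarrow> ordinal" where
  "node_order T =
    wfrec {(t, s). s \<in> T \<and> t \<in> T \<and> s \<sqsubset>\<^sub>i t}
      (\<lambda>ord s. Sup {ord_suc (ord t) | t. t \<in> T \<and> s \<sqsubset>\<^sub>i t})"

definition has_infinite_chain :: "nat set set \<Rightarrow> bool" where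
  "has_infinite_chain T \<longleftrightarrow> (\<exists>c :: nat \<Rightarrow> nat set. \<forall>n. c n \<in> T \<and> c n \<sqsubset>\<^sub>i c (Suc n))"

definition family_order :: "nat set set \<Rightarrow> ordinal" where
  "family_order F = (if has_infinite_chain (hat F) then \<omega>\<^sub>1 else node_order (hat F) {})"

lemma node_order_rec:
  assumes "\<not> has_infinite_chain T" and "s \<in> T"
  shows "node_order T s = Sup {ord_suc (node_order T t) | t. t \<in> T \<and> s \<sqsubset>\<^sub>i t}"
proof -
  let ?R = "{(t, s). s \<in> T \<and> t \<in> T \<and> s \<sqsubset>\<^sub>i t}"
  have "wf ?R"
    using assms(1) unfolding wf_iff_no_infinite_down_chain has_infinite_chain_def by auto
  then show ?thesis
    unfolding node_order_def using assms(2)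
    by (subst wfrec) (auto simp: cut_def intro!: arg_cong[where f = Sup])
qed

lemma node_order_maximal:
  assumes "\<not> has_infinite_chain T" "s \<in> T" "\<And>t. t \<in> T \<Longrightarrow> \<not> s \<sqsubset>\<^sub>i t"
  shows "node_order T s = bot"
proof -
  have "{ord_suc (node_order T t) | t. t \<in> T \<and> s \<sqsubset>\<^sub>i t} = {}"
    using assms(3) by blast
  then show ?thesis
    unfolding node_order_rec[OF assms(1,2)] by (simp only: Sup_ordinal_empty)
qed

text \<open>The suprema in the recursion are over bounded sets, hence genuine least upper bounds.\<close>

lemma bdd_above_node_order:
  assumes "T \<subseteq> Fpow \<nat>\<^sub>+"
  shows "bdd_above {ord_suc (node_order T t) | t. t \<in> T \<and> s \<sqsubset>\<^sub>i t}"
proof -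
  have "countable T"
  proof (rule countable_subset)
    show "T \<subseteq> {s. finite s \<and> s \<subseteq> \<nat>\<^sub>+}"
      using assms by (auto simp: Fpow_def)
  qed (simp add: countable_Collect_finite_subset)
  then have "countable {t \<in> T. s \<sqsubset>\<^sub>i t}"
    by (rule countable_subset[rotated]) blast
  then have "countable {ord_suc (node_order T t) | t. t \<in> T \<and> s \<sqsubset>\<^sub>i t}"
    by (simp add: setcompr_eq_image)
  then obtain b where "\<forall>a\<in>{ord_suc (node_order T t) | t. t \<in> T \<and> s \<sqsubset>\<^sub>i t}. a < b"
    using countable_ordinals_bdd_above by blast
  then show ?thesis
    by (intro bdd_aboveI[of _ b]) (blast intro: less_imp_le)
qed


section \<open>Plegma pairs\<close>

text \<open>The two clauses are stated for indices \<open>k \<ge> 1\<close>. Subtraction on \<^typ>\<open>nat\<close> does not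
  truncate in the second one, as the sets are nonempty.\<close>

definition plegma :: "nat set \<Rightarrow> nat set \<Rightarrow> bool" where
  "plegma s1 s2 \<longleftrightarrow>
    s1 \<in> Fpow \<nat>\<^sub>+ \<and> s2 \<in> Fpow \<nat>\<^sub>+ \<and> s1 \<noteq> {} \<and> s2 \<noteq> {} \<and>
    (\<forall>k\<in>{1..min (card s1) (card s2)}. elt s1 k < elt s2 k) \<and>
    (\<forall>s\<in>{s1, s2}. \<forall>t\<in>{s1, s2}. \<forall>k\<in>{1..min (card s) (card t - 1)}. elt s k < elt t (k + 1))"

definition plegma_preserving_on :: "nat set set \<Rightarrow> (nat set \<Rightarrow> nat set) \<Rightarrow> bool" where
  "plegma_preserving_on H \<phi> \<longleftrightarrow>
    (\<forall>s1\<in>H. \<forall>s2\<in>H. plegma s1 s2 \<longrightarrow> plegma (\<phi> s1) (\<phi> s2))"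

end

theory Submission
  imports Defs
begin

text \<open>Two applications of a Ramsey theorem make the colour of a plegma pair of members
  \<open>s1, s2\<close> of \<open>F\<close>, namely whether \<open>(\<phi> s1, \<phi> s2)\<close> is a plegma pair, and likewise for
  \<open>(\<phi> s2, \<phi> s1)\<close>, constant over an infinite set. It remains to exclude both positive colours.

  If all plegma pairs are reversed, then the first elements of the images along an infinite
  sequence of sets, any two consecutive ones of which form a plegma pair, decrease forever
  (\<open>not_plegma_reversing\<close>).

  If all plegma pairs are preserved, let \<open>l\<close> enumerate the infinite set, and let \<open>p\<close> be an
  infinite sequence of indices with gaps at least two. The indices can be lowered by one, over and
  over, through plegma pairs, until the first index is zero; as \<open>\<phi>\<close> preserves plegma pairs, the
  first element of the image of the initial segment of \<open>l \<circ> p\<close> in \<open>F\<close> is at least \<open>p 0\<close>.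
  Moving along plegma pairs in the other direction, from \<open>p k\<close> to \<open>p (k + 1) - 1\<close>, turns this into a
  bound for all elements: the \<open>k\<close>-th element of the image is at least \<open>p k\<close>. Since only finitely
  many terms of \<open>p\<close> matter for the image, the image has at most as many elements as its argument.
  A member of \<open>G\<close> is maximal in the closure of \<open>G\<close>, and by spreading it cannot lie above a shorter
  part of a member of that closure (\<open>no_shorter_above\<close>). Hence \<open>n \<mapsto> l (2 * n)\<close> maps the closure
  of \<open>G\<close> into the closure of \<open>F\<close> (\<open>plegma_preserving_hat_embedding\<close>). A strictly increasing map
  respects proper initial segments, so the order of \<open>G\<close> is at most that of \<open>F\<close>.

  Infinite sets are represented by their increasing enumerations throughout. The passage between
  plegma pairs of finite sets and interleaved pairs of infinite sequences is
  \<open>plegma_pairs_extend_to_interleaved\<close>.\<close>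

section \<open>Finite sets as strictly increasing sequences\<close>

lemma enumerate_image_lessThan:
  fixes x :: "nat \<Rightarrow> nat"
  assumes x: "strict_mono_on {..<n} x" and "k < n"
  shows "enumerate (x ` {..<n}) k = x k"
  using \<open>k < n\<close>
proof (induction k rule: less_induct)
  case (less k)
  let ?S = "x ` {..<n}"
  have inj: "inj_on x {..<n}"
    using x by (rule strict_mono_on_imp_inj_on)
  then have card: "card ?S = n"
    by (simp add: card_image)
  have "bij_betw (enumerate ?S) {..<n} ?S"
    using finite_bij_enumerate[of ?S] card by simp
  then obtain i where i: "i < n" "enumerate ?S i = x k"
    using less.prems by (metis bij_betw_iff_bijections imageI lessThan_iff)
  have "enumerate ?S k \<in> ?S"
    using finite_enumerate_in_set[of ?S k] less.prems card by simp
  then obtain j where j: "j < n" "enumerate ?S k = x j"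
    by auto
  have "k \<le> i"
    using less.IH[of i] i less.prems inj by (metis inj_onD lessThan_iff not_le less_irrefl)
  then have "enumerate ?S k \<le> x k"
    using i finite_enumerate_mono_iff[of ?S k i] card less.prems
    by (cases "k = i") (auto simp: less_imp_le)
  have "k \<le> j"
  proof (rule ccontr)
    assume "\<not> k \<le> j"
    then have "enumerate ?S j = enumerate ?S k"
      using less.IH[of j] j by simp
    then show False
      using finite_enumerate_mono_iff[of ?S j k] \<open>\<not> k \<le> j\<close> card less.prems by simp
  qed
  then have "x k \<le> enumerate ?S k"
    using x j less.prems by (cases "k = j") (auto simp: strict_mono_on_def less_imp_le)
  then show ?case
    using \<open>enumerate ?S k \<le> x k\<close> by simp
qed

lemma card_image_lessThan:
  fixes x :: "nat \<Rightarrow> nat"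
  shows "strict_mono_on {..<n} x \<Longrightarrow> card (x ` {..<n}) = n"
  by (simp add: card_image strict_mono_on_imp_inj_on)

lemma strict_mono_on_enumerate:
  "finite (s :: nat set) \<Longrightarrow> n \<le> card s \<Longrightarrow> strict_mono_on {..<n} (enumerate s)"
  by (auto simp: strict_mono_on_def)

lemma enumerate_image_card:
  "finite (s :: nat set) \<Longrightarrow> enumerate s ` {..<card s} = s"
  using finite_bij_enumerate by (auto simp: bij_betw_def)

lemma strict_mono_imp_strict_mono_on: "strict_mono x \<Longrightarrow> strict_mono_on A x"
  by (simp add: strict_mono_def strict_mono_on_def)

lemma extend_strict_mono_on:
  fixes x :: "nat \<Rightarrow> nat"
  assumes "strict_mono_on {..<n} x"
  obtains y where "strict_mono y" "\<And>k. k < n \<Longrightarrow> y k = x k" "\<And>k. n \<le> k \<Longrightarrow> b \<le> y k"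
proof
  let ?y = "\<lambda>k. if k < n then x k else b + x (n - 1) + k + 1"
  have "?y k < ?y (Suc k)" for k
  proof (cases "Suc k < n")
    case True
    then show ?thesis
      using assms by (simp add: strict_mono_on_def)
  next
    case False
    then show ?thesis
      by (cases "Suc k = n") auto
  qed
  then show "strict_mono ?y"
    by (simp add: strict_mono_Suc_iff)
qed auto

lemma initial_seg_image_lessThan:
  fixes x :: "nat \<Rightarrow> nat"
  assumes "strict_mono x" "m \<le> n"
  shows "x ` {..<m} \<sqsubseteq>\<^sub>i x ` {..<n}"
  unfolding initial_seg_def
proof (intro conjI ballI)
  show "x ` {..<m} \<subseteq> x ` {..<n}"
    using assms(2) by auto
  fix a b assume "a \<in> x ` {..<m}" "b \<in> x ` {..<n} - x ` {..<m}"
  then obtain i j where "i < m" "a = x i" "\<not> j < m" "b = x j"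
    by auto
  then show "a < b"
    using assms(1) by (simp add: strict_mono_less)
qed

lemma image_lessThan_inj:
  fixes x :: "nat \<Rightarrow> nat"
  assumes "strict_mono x" "x ` {..<m} = x ` {..<n}"
  shows "m = n"
  using card_image_lessThan[of _ x] assms by (metis strict_mono_imp_strict_mono_on)

section \<open>Regular thin families\<close>

context
  fixes F :: "nat set set"
  assumes F: "regular_thin F"
begin

lemma subset_hat: "F \<subseteq> hat F"
  using F by (auto simp: regular_thin_def hat_def initial_seg_def)

lemma hat_subset_Fpow: "hat F \<subseteq> Fpow \<nat>\<^sub>+"
  by (auto simp: hat_def)

lemma finite_hat: "s \<in> hat F \<Longrightarrow> finite s"
  by (auto simp: hat_def Fpow_def)

lemma hat_hereditary: "s \<in> hat F \<Longrightarrow> t \<subseteq> s \<Longrightarrow> t \<in> hat F"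
  using F by (auto simp: regular_thin_def regular_family_def hereditary_def)

lemma hat_spreading:
  fixes x y :: "nat \<Rightarrow> nat"
  assumes x: "strict_mono_on {..<n} x" and y: "strict_mono_on {..<n} y"
    and mem: "x ` {..<n} \<in> hat F" and le: "\<And>k. k < n \<Longrightarrow> x k \<le> y k"
  shows "y ` {..<n} \<in> hat F"
proof -
  have "spreading (hat F)"
    using F by (simp add: regular_thin_def regular_family_def)
  moreover have "y ` {..<n} \<in> Fpow \<nat>\<^sub>+"
  proof -
    have "x ` {..<n} \<in> Fpow \<nat>\<^sub>+"
      using mem hat_subset_Fpow by blast
    then have "1 \<le> x k" if "k < n" for k
      using that by (auto simp: Fpow_def)
    then have "1 \<le> y k" if "k < n" for k
      using that le order_trans by blast
    then show ?thesis
      by (auto simp: Fpow_def)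
  qed
  moreover have "card (y ` {..<n}) = card (x ` {..<n})"
    using x y by (simp add: card_image_lessThan)
  moreover have "\<forall>i\<in>{1..card (x ` {..<n})}. elt (x ` {..<n}) i \<le> elt (y ` {..<n}) i"
    using x y le by (auto simp: elt_def card_image_lessThan enumerate_image_lessThan)
  ultimately show ?thesis
    using mem unfolding spreading_def by blast
qed

lemma empty_in_hat: "F \<noteq> {} \<Longrightarrow> {} \<in> hat F"
  using subset_hat hat_hereditary by blast

lemma maximal_in_hat: "s \<in> F \<Longrightarrow> t \<in> hat F \<Longrightarrow> \<not> s \<sqsubset>\<^sub>i t"
proof
  assume s: "s \<in> F" and t: "t \<in> hat F" and st: "s \<sqsubset>\<^sub>i t"
  obtain u where u: "u \<in> F" "t \<sqsubseteq>\<^sub>i u"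
    using t by (auto simp: hat_def)
  have "s \<sqsubset>\<^sub>i u"
    using st u(2) unfolding proper_initial_seg_def initial_seg_def by blast
  then show False
    using F s u by (auto simp: regular_thin_def thin_def)
qed

text \<open>A set in the closure but outside of the family is a proper initial segment of some member,
  so it can be continued by the next element of that member.\<close>

lemma extendable_in_hat:
  assumes "s \<in> hat F" "s \<notin> F"
  obtains m where "\<forall>y\<in>s. y < m" "insert m s \<in> hat F"
proof -
  obtain u where u: "u \<in> F" "s \<sqsubseteq>\<^sub>i u"
    using assms by (auto simp: hat_def)
  have "s \<subseteq> u" "s \<noteq> u"
    using u assms(2) by (auto simp: initial_seg_def)
  then obtain m where m: "m \<in> u - s"
    by blast
  have "insert m s \<subseteq> u"
    using m u unfolding initial_seg_def by blast
  then have "insert m s \<in> hat F"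
    using u(1) subset_hat hat_hereditary by blast
  moreover have "\<forall>y\<in>s. y < m"
    using m u unfolding initial_seg_def by blast
  ultimately show thesis
    using that by blast
qed

text \<open>This is where compactness enters. If all initial segments of an infinite set were in
  the closure, then their characteristic functions would converge to that of the infinite set, which
  would have to agree, on the positive integers, with that of a finite set.\<close>

lemma leaves_hat:
  fixes x :: "nat \<Rightarrow> nat"
  assumes x: "strict_mono x"
  obtains n where "x ` {..<n} \<notin> hat F"
proof (rule ccontr)
  assume "\<not> thesis"
  then have mem: "x ` {..<n} \<in> hat F" for n
    using that by blast
  define f :: "nat set \<Rightarrow> nat \<Rightarrow> nat" where "f s = restrict (indicator s) \<nat>\<^sub>+" for s
  let ?X = "product_topology (\<lambda>_. discrete_topology {0, 1 :: nat}) \<nat>\<^sub>+"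
  have "limitin ?X (\<lambda>n. f (x ` {..<n})) (f (range x)) sequentially"
    unfolding limitin_componentwise
  proof (intro conjI ballI)
    show "f (range x) \<in> extensional \<nat>\<^sub>+"
      by (simp add: f_def)
    have "f s \<in> topspace ?X" for s
      by (auto simp: f_def indicator_def)
    then show "\<forall>\<^sub>F n in sequentially. f (x ` {..<n}) \<in> topspace ?X"
      by simp
    fix i :: nat assume i: "i \<in> \<nat>\<^sub>+"
    have "f (x ` {..<n}) i = f (range x) i" if "i < n" for n
    proof -
      have "i \<in> range x \<longleftrightarrow> i \<in> x ` {..<n}"
        using that le_less_trans[OF strict_mono_imp_increasing[OF x]] by blast
      then show ?thesis
        using i by (simp add: f_def indicator_def)
    qed
    then have "\<forall>\<^sub>F n in sequentially. f (x ` {..<n}) i = f (range x) i"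
      using eventually_gt_at_top[of i] by (rule eventually_mono[rotated])
    moreover have "f (range x) i \<in> {0, 1}"
      using i by (simp add: f_def indicator_def)
    ultimately show "limitin (discrete_topology {0, 1}) (\<lambda>n. f (x ` {..<n}) i) (f (range x) i)
        sequentially"
      by (intro limitin_eventually) simp_all
  qed
  moreover have "closedin ?X (f ` hat F)"
    using F by (simp add: regular_thin_def regular_family_def compact_family_def f_def[abs_def])
  ultimately have "f (range x) \<in> f ` hat F"
    by (rule limitin_closedin) (use mem in auto)
  then obtain s where s: "s \<in> hat F" "f (range x) = f s"
    by blast
  \<comment> \<open>The term \<open>x 0\<close> may be zero, on which the characteristic functions carry no
    information.\<close>
  have "x ` {1..} \<subseteq> s"
  proof
    fix m assume "m \<in> x ` {1..}"
    then obtain k where "m = x k" "1 \<le> k"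
      by auto
    then have "1 \<le> m"
      using strict_mono_imp_increasing[OF x, of k] by simp
    then have "indicator s m = (1 :: nat)"
      using fun_cong[OF s(2), of m] \<open>m = x k\<close> by (simp add: f_def)
    then show "m \<in> s"
      by (rule indicator_eq_1_iff[THEN iffD1])
  qed
  moreover have "infinite (x ` {1..})"
    using x by (metis finite_imageD infinite_Ici strict_mono_imp_inj_on inj_on_subset subset_UNIV)
  ultimately show False
    using finite_hat[OF s(1)] finite_subset by blast
qed

text \<open>The union of an infinite chain is an infinite set, and each of its finite subsets lies in
  a member of the chain, hence in the closure. This contradicts \<open>leaves_hat\<close>.\<close>

lemma no_infinite_chain: "\<not> has_infinite_chain (hat F)"
proof
  assume "has_infinite_chain (hat F)"
  then obtain c where c: "\<And>n. c n \<in> hat F" "\<And>n. c n \<sqsubset>\<^sub>i c (Suc n)"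
    unfolding has_infinite_chain_def by blast
  have "c n \<subset> c (Suc n)" for n
    using c(2)[of n] by (auto simp: proper_initial_seg_def initial_seg_def)
  then have sm: "strict_mono c"
    by (simp add: strict_mono_Suc_iff)
  have "infinite (\<Union>n. c n)"
  proof
    assume "finite (\<Union>n. c n)"
    then have "finite (range c)"
      by (meson Sup_upper finite_UnionD)
    moreover have "inj c"
      using sm by (rule strict_mono_on_imp_inj_on)
    ultimately show False
      using finite_imageD by blast
  qed
  then obtain x :: "nat \<Rightarrow> nat" where x: "strict_mono x" "\<And>n. x n \<in> (\<Union>n. c n)"
    using infinite_enumerate by blast
  obtain n where n: "x ` {..<n} \<notin> hat F"
    using leaves_hat[OF x(1)] .
  have "\<forall>i. \<exists>k. x i \<in> c k"
    using x(2) by blast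
  then obtain m where m: "\<And>i. x i \<in> c (m i)"
    by metis
  have "x ` {..<n} \<subseteq> c (Max (m ` {..<n}))"
  proof
    fix y assume "y \<in> x ` {..<n}"
    then obtain i where i: "i < n" "y = x i"
      by auto
    then have "m i \<le> Max (m ` {..<n})"
      by simp
    then have "c (m i) \<subseteq> c (Max (m ` {..<n}))"
      using strict_mono_leD[OF sm] by blast
    then show "y \<in> c (Max (m ` {..<n}))"
      using m i by blast
  qed
  then show False
    using n c(1) hat_hereditary by blast
qed

text \<open>Otherwise, appending a sufficiently large number to \<open>v\<close> gives a set which lies
  above the first \<open>card v + 1\<close> elements of \<open>u\<close>. By spreading it is in the closure, although \<open>v\<close> is
  maximal there.\<close>

lemma no_shorter_above:
  assumes u: "u \<in> hat F" and v: "v \<in> F" and card: "card v < card u"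
    and le: "\<And>k. k < card v \<Longrightarrow> enumerate u k \<le> enumerate v k"
  shows False
proof -
  let ?n = "card v"
  have fin: "finite u" "finite v"
    using u v subset_hat finite_hat by auto
  obtain y where y: "strict_mono y" "\<And>k. k < ?n \<Longrightarrow> y k = enumerate v k"
      "\<And>k. ?n \<le> k \<Longrightarrow> enumerate u ?n \<le> y k"
    using extend_strict_mono_on[OF strict_mono_on_enumerate[OF fin(2) order_refl]] by metis
  have v_eq: "y ` {..<?n} = v"
    using enumerate_image_card[OF fin(2)] y(2) by auto
  have "enumerate u ` {..<Suc ?n} \<in> hat F"
  proof (rule hat_hereditary[OF u])
    show "enumerate u ` {..<Suc ?n} \<subseteq> u"
      using enumerate_image_card[OF fin(1)] card by (auto simp: finite_enumerate_in_set fin)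
  qed
  moreover have "enumerate u k \<le> y k" if "k < Suc ?n" for k
    using that le y(2,3) by (cases "k = ?n") auto
  ultimately have "y ` {..<Suc ?n} \<in> hat F"
    using hat_spreading[of "Suc ?n" "enumerate u" y] strict_mono_on_enumerate[of u "Suc ?n"]
      strict_mono_imp_strict_mono_on[OF y(1)] fin card by simp
  moreover have "v \<sqsubset>\<^sub>i y ` {..<Suc ?n}"
    using initial_seg_image_lessThan[OF y(1), of ?n "Suc ?n"] image_lessThan_inj[OF y(1)] v_eq
    unfolding proper_initial_seg_def by (metis le_SucI n_not_Suc_n order_refl)
  ultimately show False
    using maximal_in_hat v by blast
qed

end

lemma plegma_less: "plegma s t \<Longrightarrow> k < card s \<Longrightarrow> k < card t \<Longrightarrow> enumerate s k < enumerate t k"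
  unfolding plegma_def elt_def by (auto dest!: bspec[where x = "Suc k"])

lemma plegma_less_Suc:
  assumes "plegma s1 s2" "s \<in> {s1, s2}" "t \<in> {s1, s2}" "k < card s" "Suc k < card t"
  shows "enumerate s k < enumerate t (Suc k)"
proof -
  have "Suc k \<in> {1..min (card s) (card t - 1)}"
    using assms(4,5) by auto
  then have "elt s (Suc k) < elt t (Suc k + 1)"
    using assms(1-3) unfolding plegma_def by blast
  then show ?thesis
    by (simp add: elt_def)
qed

text \<open>If \<open>t\<close> were shorter, it would lie above the first \<open>card t\<close> elements of \<open>s\<close>.\<close>

lemma plegma_card_le:
  assumes F: "regular_thin F" and "s \<in> F" "t \<in> F" "plegma s t"
  shows "card s \<le> card t"
proof (rule ccontr)
  assume "\<not> ?thesis"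
  then show False
    using no_shorter_above[OF F, of s t] subset_hat[OF F] assms plegma_less[of s t]
    by (auto simp: less_imp_le)
qed

section \<open>A Ramsey theorem for locally constant colourings of infinite sets\<close>

text \<open>A finite sequence \<open>s\<close> is good if every infinite \<open>N \<subseteq> M\<close> contains an infinite
  \<open>L\<close> such that all sequences which start with \<open>s\<close> and continue in \<open>L\<close> have the same colour. If all
  one-point extensions of \<open>s\<close> are good, then so is \<open>s\<close>: on a diagonal sequence through successive
  thinnings the colour depends on the next term only, and some colour belongs to infinitely many next
  terms. Hence if the empty sequence were bad, there would be an infinite sequence with only bad initial
  segments; but one of them decides the colour.\<close>

lemma locally_constant_Ramsey:
  fixes P :: "(nat \<Rightarrow> nat) \<Rightarrow> bool"
  assumes loc: "\<And>f. strict_mono f \<Longrightarrow> range f \<subseteq> M \<Longrightarrow>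
      \<exists>n. \<forall>g. strict_mono g \<and> range g \<subseteq> M \<and> (\<forall>i<n. g i = f i) \<longrightarrow> P g = P f"
    and M: "infinite M"
  obtains L c where "L \<subseteq> M" "infinite L" "\<And>f. strict_mono f \<Longrightarrow> range f \<subseteq> L \<Longrightarrow> P f = c"
proof -
  define ext where "ext s N = {f. strict_mono f \<and> range f \<subseteq> M \<and>
      (\<forall>i<length s. f i = s ! i) \<and> (\<forall>i\<ge>length s. f i \<in> N)}" for s :: "nat list" and N
  define hom where "hom s N c \<longleftrightarrow> (\<forall>f\<in>ext s N. P f = c)" for s N c
  define good where "good s \<longleftrightarrow>
      (\<forall>N. N \<subseteq> M \<and> infinite N \<longrightarrow> (\<exists>L c. L \<subseteq> N \<and> infinite L \<and> hom s L c))" for s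
  have step: "good s" if good: "\<And>m. m \<in> M \<Longrightarrow> good (s @ [m])" for s
    unfolding good_def
  proof (intro allI impI, elim conjE)
    fix N assume N: "N \<subseteq> M" "infinite N"
    define lst where "lst X = (LEAST x. x \<in> X)" for X :: "nat set"
    have lst: "lst X \<in> X" if "infinite X" for X
      using that LeastI_ex[of "\<lambda>x. x \<in> X"] unfolding lst_def by (metis ex_in_conv finite.emptyI)
    \<comment> \<open>\<open>X (n + 1)\<close> is homogeneous for \<open>s\<close> extended by the least element of \<open>X n\<close>.\<close>
    have "\<exists>X. \<forall>n. (X n \<subseteq> N \<and> infinite (X n)) \<and>
        (X (Suc n) \<subseteq> X n - {..lst (X n)} \<and> (\<exists>c. hom (s @ [lst (X n)]) (X (Suc n)) c))"
    proof (rule dependent_nat_choice)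
      show "\<exists>X. X \<subseteq> N \<and> infinite X"
        using N by blast
      fix X assume X: "X \<subseteq> N \<and> infinite X"
      let ?Y = "X - {..lst X}"
      have "infinite ?Y"
        using X by (simp add: Diff_infinite_finite)
      moreover have "?Y \<subseteq> M" "lst X \<in> M"
        using X N lst by auto
      ultimately obtain L c where "L \<subseteq> ?Y" "infinite L" "hom (s @ [lst X]) L c"
        using good[of "lst X"] unfolding good_def by meson
      then show "\<exists>Y. (Y \<subseteq> N \<and> infinite Y) \<and>
          (Y \<subseteq> X - {..lst X} \<and> (\<exists>c. hom (s @ [lst X]) Y c))"
        using X by blast
    qed
    then obtain X where "\<forall>n. (X n \<subseteq> N \<and> infinite (X n)) \<and>
        (X (Suc n) \<subseteq> X n - {..lst (X n)} \<and> (\<exists>c. hom (s @ [lst (X n)]) (X (Suc n)) c))" ..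
    then have X: "\<And>n. X n \<subseteq> N" "\<And>n. infinite (X n)"
        "\<And>n. X (Suc n) \<subseteq> X n - {..lst (X n)}" "\<And>n. \<exists>c. hom (s @ [lst (X n)]) (X (Suc n)) c"
      by simp_all
    define m where "m n = lst (X n)" for n
    from X(4) obtain c where c: "\<And>n. hom (s @ [m n]) (X (Suc n)) (c n)"
      unfolding m_def by metis
    have m_in: "m n \<in> X n" for n
      unfolding m_def using X(2) by (rule lst)
    have "X (Suc n) \<subseteq> X n" for n
      using X(3)[of n] by blast
    then have anti: "X j \<subseteq> X i" if "i \<le> j" for i j
      using that by (rule lift_Suc_antimono_le)
    have m_mono: "strict_mono m"
      unfolding strict_mono_Suc_iff
    proof
      fix n
      have "m (Suc n) \<in> X n - {..m n}"
        using m_in[of "Suc n"] X(3)[of n] unfolding m_def by blast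
      then show "m n < m (Suc n)"
        by simp
    qed
    obtain k0 where I: "infinite {k. c k = c k0}"
      using pigeonhole_infinite[of "UNIV :: nat set" c] by auto
    let ?L = "m ` {k. c k = c k0}"
    have "?L \<subseteq> N"
      using m_in X(1) by blast
    moreover have "infinite ?L"
      using I m_mono by (metis finite_imageD inj_on_subset strict_mono_imp_inj_on subset_UNIV)
    moreover have "hom s ?L (c k0)"
      unfolding hom_def
    proof
      fix f assume f: "f \<in> ext s ?L"
      then have f_mono: "strict_mono f"
        by (simp add: ext_def)
      have "f (length s) \<in> ?L"
        using f by (simp add: ext_def)
      then obtain k where k: "f (length s) = m k" "c k = c k0"
        by blast
      have "f i \<in> X (Suc k)" if "length (s @ [m k]) \<le> i" for i
      proof -
        have "f i \<in> ?L"
          using f that by (simp add: ext_def)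
        then obtain j where j: "f i = m j"
          by blast
        have "m k < m j"
          using that f_mono k j by (metis Suc_le_lessD length_append_singleton strict_monoD)
        then have "Suc k \<le> j"
          using m_mono by (simp add: strict_mono_less Suc_le_eq)
        then show ?thesis
          using j m_in[of j] anti by auto
      qed
      then have "f \<in> ext (s @ [m k]) (X (Suc k))"
        using f k(1) by (auto simp: ext_def nth_append less_Suc_eq)
      then show "P f = c k0"
        using c[of k] k(2) by (auto simp: hom_def)
    qed
    ultimately show "\<exists>L c. L \<subseteq> N \<and> infinite L \<and> hom s L c"
      by blast
  qed
  have "good []"
  proof (rule ccontr)
    assume bad: "\<not> good []"
    have "\<exists>s. \<forall>n. (\<not> good (s n) \<and> length (s n) = n) \<and> (\<exists>m\<in>M. s (Suc n) = s n @ [m])"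
    proof (rule dependent_nat_choice)
      show "\<exists>s. \<not> good s \<and> length s = 0"
        using bad by simp
      show "\<exists>t. (\<not> good t \<and> length t = Suc n) \<and> (\<exists>m\<in>M. t = s @ [m])"
        if "\<not> good s \<and> length s = n" for s n
        using that step by (metis length_append_singleton)
    qed
    then obtain s where "\<forall>n. (\<not> good (s n) \<and> length (s n) = n) \<and> (\<exists>m\<in>M. s (Suc n) = s n @ [m])" ..
    then have s: "\<And>n. \<not> good (s n)" "\<And>n. length (s n) = n"
        "\<And>n. \<exists>m\<in>M. s (Suc n) = s n @ [m]"
      by simp_all
    from s(3) obtain x where x: "\<And>n. x n \<in> M" "\<And>n. s (Suc n) = s n @ [x n]"
      by metis
    have nth: "s n ! i = x i" if "i < n" for n i
      using that by (induction n) (auto simp: x(2) nth_append s(2) less_Suc_eq)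
    \<comment> \<open>A bad sequence has a strictly increasing continuation, since otherwise it would be good
      vacuously; hence it is itself increasing.\<close>
    have nonempty: "\<exists>N f. f \<in> ext (s n) N" for n
    proof (rule ccontr)
      assume "\<nexists>N f. f \<in> ext (s n) N"
      then have "hom (s n) N c" for N c
        by (simp add: hom_def)
      then have "good (s n)"
        unfolding good_def by blast
      then show False
        using s(1) by blast
    qed
    have "strict_mono x"
      unfolding strict_mono_Suc_iff
    proof
      fix i
      obtain N f where "f \<in> ext (s (Suc (Suc i))) N"
        using nonempty by blast
      then have "strict_mono f" "f i = x i" "f (Suc i) = x (Suc i)"
        by (auto simp: ext_def s(2) nth)
      then show "x i < x (Suc i)"
        by (metis lessI strict_monoD)
    qed
    moreover have "range x \<subseteq> M"
      using x by auto
    ultimately obtain n where n: "\<forall>g. strict_mono g \<and> range g \<subseteq> M \<and> (\<forall>i<n. g i = x i) \<longrightarrow> P g = P x"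
      using loc by blast
    have "hom (s n) N (P x)" if "N \<subseteq> M" for N
      using n by (auto simp: hom_def ext_def s(2) nth)
    then have "good (s n)"
      unfolding good_def by blast
    then show False
      using s(1) by blast
  qed
  then obtain L c where L: "L \<subseteq> M" "infinite L" "hom [] L c"
    using M unfolding good_def by blast
  have "P f = c" if "strict_mono f" "range f \<subseteq> L" for f
  proof -
    have "f \<in> ext [] L"
      using L(1) that by (auto simp: ext_def)
    then show ?thesis
      using L(3) by (simp add: hom_def)
  qed
  then show thesis
    using that L by blast
qed

section \<open>Initial segments of infinite sets in a thin family\<close>

definition very_large :: "nat set set \<Rightarrow> nat set \<Rightarrow> bool" where
  "very_large F M \<longleftrightarrow> (\<forall>x :: nat \<Rightarrow> nat. strict_mono x \<and> range x \<subseteq> M \<longrightarrow> (\<exists>n. x ` {..<n} \<in> F))"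

lemma very_large_subset: "very_large F M \<Longrightarrow> L \<subseteq> M \<Longrightarrow> very_large F L"
  by (auto simp: very_large_def)

text \<open>A set in the closure but outside of the family can be continued by all sufficiently large
  numbers, by spreading. There are only finitely many subsets of \<open>{..a}\<close>, so a sparse enough infinite
  set respects these thresholds for all of its finite subsets. In such a set, the longest initial
  segment in the closure, which exists by \<open>leaves_hat\<close>, has to be in the family.\<close>

lemma exists_very_large:
  assumes F: "regular_thin F" "F \<noteq> {}" and M: "infinite M"
  obtains L where "L \<subseteq> M" "infinite L" "very_large F L"
proof -
  have "\<exists>b. \<forall>m\<ge>b. insert m s \<in> hat F" if s: "s \<in> hat F - F" for s
  proof -
    obtain b where b: "\<forall>y\<in>s. y < b" "insert b s \<in> hat F"
      using extendable_in_hat[OF F(1)] s by blast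
    have fin: "finite s"
      using s finite_hat[OF F(1)] by blast
    have upd: "(enumerate s)(card s := m) ` {..<Suc (card s)} = insert m s" for m
      using enumerate_image_card[OF fin] by (auto simp: lessThan_Suc image_iff)
    have mono: "strict_mono_on {..<Suc (card s)} ((enumerate s)(card s := m))" if "b \<le> m" for m
      using that b(1) finite_enumerate_in_set[OF fin] fin
      by (auto simp: strict_mono_on_def less_Suc_eq intro: less_le_trans)
    have "insert m s \<in> hat F" if "b \<le> m" for m
    proof -
      have "((enumerate s)(card s := m)) ` {..<Suc (card s)} \<in> hat F"
      proof (rule hat_spreading[OF F(1) mono[OF order_refl] mono[OF that]])
        show "((enumerate s)(card s := b)) ` {..<Suc (card s)} \<in> hat F"
          using b(2) unfolding upd .
      qed (use that in auto)
      then show ?thesis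
        unfolding upd .
    qed
    then show ?thesis
      by blast
  qed
  then obtain b where b: "\<And>s m. s \<in> hat F - F \<Longrightarrow> b s \<le> m \<Longrightarrow> insert m s \<in> hat F"
    by metis
  define g where "g a = Max (b ` Pow {..a})" for a :: nat
  have g: "insert m s \<in> hat F" if "s \<in> hat F - F" "s \<subseteq> {..a}" "g a \<le> m" for s a m
  proof (rule b[OF that(1)])
    have "b s \<le> g a"
      unfolding g_def using that(2) by (intro Max_ge) auto
    then show "b s \<le> m"
      using that(3) by simp
  qed
  have large: "\<exists>m\<in>M. k \<le> m" for k
    using M by (meson infinite_nat_iff_unbounded_le)
  have "\<exists>r. \<forall>n. (r n \<in> M \<and> g 0 \<le> r n) \<and> (r n < r (Suc n) \<and> g (r n) \<le> r (Suc n))"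
  proof (rule dependent_nat_choice)
    show "\<exists>r. r \<in> M \<and> g 0 \<le> r"
      using large by blast
    fix r assume "r \<in> M \<and> g 0 \<le> r"
    then show "\<exists>q. (q \<in> M \<and> g 0 \<le> q) \<and> (r < q \<and> g r \<le> q)"
      using large[of "Suc r + g r + g 0"] by force
  qed
  then obtain r where r: "\<And>n. r n \<in> M" "\<And>n. g 0 \<le> r n" "\<And>n. r n < r (Suc n)"
      "\<And>n. g (r n) \<le> r (Suc n)"
    by blast
  have r_mono: "strict_mono r"
    using r(3) by (simp add: strict_mono_Suc_iff)
  have "very_large F (range r)"
    unfolding very_large_def
  proof (intro allI impI, elim conjE)
    fix x :: "nat \<Rightarrow> nat" assume x: "strict_mono x" "range x \<subseteq> range r"
    show "\<exists>n. x ` {..<n} \<in> F"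
    proof (rule ccontr)
      assume none: "\<nexists>n. x ` {..<n} \<in> F"
      have "x ` {..<n} \<in> hat F" for n
      proof (induction n)
        case 0
        show ?case
          using empty_in_hat[OF F] by simp
      next
        case (Suc n)
        then have s: "x ` {..<n} \<in> hat F - F"
          using none by blast
        have "insert (x n) (x ` {..<n}) \<in> hat F"
        proof (cases n)
          case 0
          have "x n \<in> range r"
            using x(2) by blast
          then show ?thesis
            using g[OF s, of 0 "x n"] 0 r(2) by auto
        next
          case (Suc k)
          obtain i j where ij: "x k = r i" "x n = r j"
            using x(2) by blast
          have "r i < r j"
            using x(1) Suc ij by (metis lessI strict_monoD)
          then have "Suc i \<le> j"
            using r_mono by (simp add: strict_mono_less Suc_le_eq)
          then have "g (x k) \<le> x n"
            using r(4)[of i] strict_mono_leD[OF r_mono, of "Suc i" j] ij by simp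
          moreover have "x ` {..<n} \<subseteq> {..x k}"
            using strict_mono_leD[OF x(1)] Suc by auto
          ultimately show ?thesis
            using g[OF s] by blast
        qed
        then show ?case
          by (simp add: lessThan_Suc)
      qed
      then show False
        using leaves_hat[OF F(1) x(1)] by blast
    qed
  qed
  moreover have "infinite (range r)"
    using r_mono by (simp add: range_inj_infinite strict_mono_imp_inj_on)
  ultimately show thesis
    using that[of "range r"] r(1) by blast
qed

text \<open>For a thin family there is at most one initial segment to choose.\<close>

definition first_in :: "nat set set \<Rightarrow> (nat \<Rightarrow> nat) \<Rightarrow> nat set" where
  "first_in F x = (THE s. s \<in> F \<and> (\<exists>n. s = x ` {..<n}))"

lemma first_in_eq:
  assumes F: "thin F" and x: "strict_mono x" and n: "x ` {..<n} \<in> F"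
  shows "first_in F x = x ` {..<n}"
  unfolding first_in_def
proof (rule the_equality)
  fix s assume "s \<in> F \<and> (\<exists>n. s = x ` {..<n})"
  then obtain m where m: "s = x ` {..<m}" "s \<in> F"
    by blast
  have "\<not> x ` {..<m} \<sqsubset>\<^sub>i x ` {..<n}" "\<not> x ` {..<n} \<sqsubset>\<^sub>i x ` {..<m}"
    using F n m by (auto simp: thin_def)
  then show "s = x ` {..<n}"
    using initial_seg_image_lessThan[OF x] m(1) nat_le_linear[of m n]
    unfolding proper_initial_seg_def by metis
qed (use n in blast)

lemma first_in_very_large:
  assumes "very_large F M" "thin F" "strict_mono x" "range x \<subseteq> M"
  obtains n where "first_in F x = x ` {..<n}" "x ` {..<n} \<in> F"
  using assms first_in_eq unfolding very_large_def by metis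

definition interleaved :: "(nat \<Rightarrow> nat) \<Rightarrow> (nat \<Rightarrow> nat) \<Rightarrow> bool" where
  "interleaved p q \<longleftrightarrow> (\<forall>k. p k < q k \<and> q k < p (Suc k))"

lemma interleaved_strict_mono: "interleaved p q \<Longrightarrow> strict_mono p \<and> strict_mono q"
  by (auto simp: interleaved_def strict_mono_Suc_iff intro: less_trans)

text \<open>An interleaved pair is the same as one sequence, split into its terms of even and of odd
  index. The initial segments in \<open>F\<close> are finite, so the induced colouring is locally constant.\<close>

lemma interleaved_Ramsey:
  fixes Q :: "nat set \<Rightarrow> nat set \<Rightarrow> bool"
  assumes F: "thin F" and M: "very_large F M" "infinite M"
  obtains L c where "L \<subseteq> M" "infinite L"
    "\<And>p q. interleaved p q \<Longrightarrow> range p \<subseteq> L \<Longrightarrow> range q \<subseteq> L \<Longrightarrow> Q (first_in F p) (first_in F q) = c"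
proof -
  define ev od :: "(nat \<Rightarrow> nat) \<Rightarrow> nat \<Rightarrow> nat"
    where "ev f = (\<lambda>k. f (2 * k))" and "od f = (\<lambda>k. f (2 * k + 1))" for f
  have split: "strict_mono (ev f)" "strict_mono (od f)" "range (ev f) \<subseteq> N" "range (od f) \<subseteq> N"
    if "strict_mono f" "range f \<subseteq> N" for f N
    using that by (auto simp: ev_def od_def strict_mono_def)
  have loc: "\<exists>n. \<forall>g. strict_mono g \<and> range g \<subseteq> M \<and> (\<forall>i<n. g i = f i) \<longrightarrow>
      Q (first_in F (ev g)) (first_in F (od g)) = Q (first_in F (ev f)) (first_in F (od f))"
    if f: "strict_mono f" "range f \<subseteq> M" for f
  proof -
    obtain a where a: "first_in F (ev f) = ev f ` {..<a}" "ev f ` {..<a} \<in> F"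
      using first_in_very_large[OF M(1) F split(1,3)] f by metis
    obtain b where b: "first_in F (od f) = od f ` {..<b}" "od f ` {..<b} \<in> F"
      using first_in_very_large[OF M(1) F split(2,4)] f by metis
    have "first_in F (ev g) = first_in F (ev f) \<and> first_in F (od g) = first_in F (od f)"
      if g: "strict_mono g" "range g \<subseteq> M" "\<forall>i<2 * a + 2 * b. g i = f i" for g
    proof -
      have "ev g ` {..<a} = ev f ` {..<a}" "od g ` {..<b} = od f ` {..<b}"
        using g(3) by (auto simp: ev_def od_def intro!: image_cong)
      then show ?thesis
        using a b first_in_eq[OF F split(1)[OF g(1,2)], of a]
          first_in_eq[OF F split(2)[OF g(1,2)], of b] by simp
    qed
    then show ?thesis
      by metis
  qed
  obtain L c where L: "L \<subseteq> M" "infinite L" and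
    c: "\<And>f. strict_mono f \<Longrightarrow> range f \<subseteq> L \<Longrightarrow> Q (first_in F (ev f)) (first_in F (od f)) = c"
    using locally_constant_Ramsey[OF loc M(2)] by blast
  have "Q (first_in F p) (first_in F q) = c"
    if pq: "interleaved p q" "range p \<subseteq> L" "range q \<subseteq> L" for p q
  proof -
    define f where "f n = (if even n then p (n div 2) else q (n div 2))" for n
    have "strict_mono f"
      using pq(1) by (auto simp: strict_mono_Suc_iff f_def interleaved_def elim!: oddE evenE)
    moreover have "range f \<subseteq> L"
      using pq by (auto simp: f_def)
    moreover have "ev f = p" "od f = q"
      by (auto simp: f_def ev_def od_def)
    ultimately show ?thesis
      using c[of f] by simp
  qed
  then show thesis
    using that L by blast
qed

section \<open>Plegma pairs and interleaved sequences\<close>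

lemma plegma_interleaved:
  assumes pq: "interleaved p q" and ran: "range p \<subseteq> \<nat>\<^sub>+" "range q \<subseteq> \<nat>\<^sub>+" and "0 < m" "0 < n"
  shows "plegma (p ` {..<m}) (q ` {..<n})"
proof -
  have less: "p k < q k" "q k < p (Suc k)" for k
    using pq by (auto simp: interleaved_def)
  have mono: "strict_mono p" "strict_mono q"
    using interleaved_strict_mono[OF pq] by auto
  have card: "card (p ` {..<i}) = i" "card (q ` {..<i}) = i" for i
    using mono by (simp_all add: card_image_lessThan strict_mono_imp_strict_mono_on)
  have elt: "elt (p ` {..<i}) (Suc k) = p k" "elt (q ` {..<i}) (Suc k) = q k" if "k < i" for i k
    using mono that by (simp_all add: elt_def enumerate_image_lessThan strict_mono_imp_strict_mono_on)
  have less': "p k < p (Suc k)" "q k < q (Suc k)" "p k < q (Suc k)" for k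
    using mono less(2)[of k] less(1)[of "Suc k"] unfolding strict_mono_Suc_iff
    by (blast intro: less_trans)+
  have 1: "\<forall>k\<in>{1..min (card (p ` {..<m})) (card (q ` {..<n}))}. elt (p ` {..<m}) k < elt (q ` {..<n}) k"
  proof
    fix k assume "k \<in> {1..min (card (p ` {..<m})) (card (q ` {..<n}))}"
    then obtain i where "k = Suc i" "i < m" "i < n"
      by (cases k) (auto simp: card)
    then show "elt (p ` {..<m}) k < elt (q ` {..<n}) k"
      using less by (simp add: elt)
  qed
  have 2: "\<forall>k\<in>{1..min i (j - 1)}. elt (x ` {..<i}) k < elt (y ` {..<j}) (k + 1)"
    if "x \<in> {p, q}" "y \<in> {p, q}" for i j x y
  proof
    fix k assume "k \<in> {1..min i (j - 1)}"
    then obtain r where "k = Suc r" "r < i" "Suc r < j"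
      by (cases k) auto
    then show "elt (x ` {..<i}) k < elt (y ` {..<j}) (k + 1)"
      using that less less' by (auto simp: elt)
  qed
  have "\<forall>k\<in>{1..min (card s) (card t - 1)}. elt s k < elt t (k + 1)"
    if "s \<in> {p ` {..<m}, q ` {..<n}}" "t \<in> {p ` {..<m}, q ` {..<n}}" for s t
    using that 2[of p p m m] 2[of p q m n] 2[of q p n m] 2[of q q n n] by (auto simp: card)
  moreover have "p ` {..<m} \<in> Fpow \<nat>\<^sub>+ \<and> q ` {..<n} \<in> Fpow \<nat>\<^sub>+ \<and>
    p ` {..<m} \<noteq> {} \<and> q ` {..<n} \<noteq> {}"
    using ran assms(4,5) by (auto simp: Fpow_def)
  ultimately show ?thesis
    using 1 unfolding plegma_def by blast
qed

text \<open>The shorter set \<open>s\<close> of a plegma pair ends early, so its continuation needs a term between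
  any two of the remaining elements of \<open>t\<close>. These terms exist if \<open>L\<close> consists of every
  second term of an increasing sequence in \<open>N\<close>: for \<open>v\<close> in \<open>L\<close>, the element \<open>before v\<close> of \<open>N\<close>
  separates \<open>v\<close> from the smaller elements of \<open>L\<close>.\<close>

lemma plegma_pairs_extend_to_interleaved:
  assumes N: "infinite (N :: nat set)"
  obtains L where "L \<subseteq> N" "infinite L"
    "\<And>s t. s \<subseteq> L \<Longrightarrow> t \<subseteq> L \<Longrightarrow> plegma s t \<Longrightarrow> card s \<le> card t \<Longrightarrow>
      \<exists>p q. interleaved p q \<and> range p \<subseteq> N \<and> range q \<subseteq> N \<and>
        p ` {..<card s} = s \<and> q ` {..<card t} = t"
proof -
  obtain l :: "nat \<Rightarrow> nat" where l: "strict_mono l" "\<And>n. l n \<in> N"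
    using infinite_enumerate[OF N] by blast
  define L where "L = range (\<lambda>i. l (2 * i + 1))"
  have L_N: "L \<subseteq> N"
    using l(2) by (auto simp: L_def)
  have "\<exists>w\<in>N. w < v \<and> (\<forall>y\<in>L. y < v \<longrightarrow> y < w)" if v: "v \<in> L" for v
  proof -
    obtain i where i: "v = l (2 * i + 1)"
      using v by (auto simp: L_def)
    have "y < l (2 * i)" if y: "y \<in> L" "y < v" for y
    proof -
      obtain j where j: "y = l (2 * j + 1)"
        using y by (auto simp: L_def)
      have "2 * j + 1 < 2 * i + 1"
        using y(2) l(1) unfolding i j by (simp only: strict_mono_less)
      then show ?thesis
        using l(1) unfolding j by (simp add: strict_mono_less)
    qed
    then show ?thesis
      using l i by (intro bexI[of _ "l (2 * i)"]) (auto simp: strict_mono_less)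
  qed
  then obtain before where before: "\<And>v. v \<in> L \<Longrightarrow> before v \<in> N" "\<And>v. v \<in> L \<Longrightarrow> before v < v"
      "\<And>v y. v \<in> L \<Longrightarrow> y \<in> L \<Longrightarrow> y < v \<Longrightarrow> y < before v"
    by metis
  have "\<exists>p q. interleaved p q \<and> range p \<subseteq> N \<and> range q \<subseteq> N \<and>
      p ` {..<card s} = s \<and> q ` {..<card t} = t"
    if st: "s \<subseteq> L" "t \<subseteq> L" and pl: "plegma s t" and le: "card s \<le> card t" for s t
  proof -
    have fin: "finite s" "finite t"
      using pl by (auto simp: plegma_def Fpow_def)
    let ?a = "card s" and ?b = "card t" and ?x = "enumerate s" and ?y = "enumerate t"
    define c where "c = Suc (Max (s \<union> t))"
    define p where "p k = (if k < ?a then ?x k else if k < ?b then before (?y k) else l (c + 2 * k))"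
      for k
    define q where "q k = (if k < ?b then ?y k else l (c + 2 * k + 1))" for k
    have in_L: "k < ?a \<Longrightarrow> ?x k \<in> L" "k < ?b \<Longrightarrow> ?y k \<in> L" for k
      using st finite_enumerate_in_set fin by blast+
    have below: "v < l (c + k)" if "v \<in> s \<union> t" for v k
    proof -
      have "v \<le> Max (s \<union> t)"
        using fin that by (intro Max_ge) auto
      also have "\<dots> < c + k"
        by (simp add: c_def)
      also have "\<dots> \<le> l (c + k)"
        using l(1) by (rule strict_mono_imp_increasing)
      finally show ?thesis .
    qed
    have y_below: "?y k < l (c + i)" if "k < ?b" for k i
      using below that finite_enumerate_in_set fin by blast
    have "p k < q k \<and> q k < p (Suc k)" for k
    proof
      show "p k < q k"
        using plegma_less[OF pl, of k] before(2)[OF in_L(2), of k] le l(1)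
        by (simp add: p_def q_def strict_mono_less)
      show "q k < p (Suc k)"
      proof -
        consider "Suc k < ?a" | "?a \<le> Suc k" "Suc k < ?b" | "k < ?b" "?b \<le> Suc k" | "?b \<le> k"
          by linarith
        then show ?thesis
        proof cases
          case 1
          then show ?thesis
            using plegma_less_Suc[OF pl, of t s k] le by (simp add: p_def q_def)
        next
          case 2
          then have "?y k < before (?y (Suc k))"
            using fin by (intro before(3) in_L finite_enumerate_mono) auto
          then show ?thesis
            using 2 by (simp add: p_def q_def)
        next
          case 3
          then show ?thesis
            using y_below[of k "2 * Suc k"] le by (simp add: p_def q_def)
        next
          case 4
          then show ?thesis
            using l(1) le by (simp add: p_def q_def strict_mono_less)
        qed
      qed
    qed
    then have "interleaved p q"
      by (simp add: interleaved_def)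
    moreover have "p k \<in> N \<and> q k \<in> N" for k
      using in_L[of k] before(1)[OF in_L(2), of k] l(2) L_N by (simp add: p_def q_def subset_iff)
    then have "range p \<subseteq> N" "range q \<subseteq> N"
      by blast+
    moreover have "p ` {..<?a} = ?x ` {..<?a}" "q ` {..<?b} = ?y ` {..<?b}"
      by (intro image_cong refl, simp add: p_def q_def)+
    then have "p ` {..<?a} = s" "q ` {..<?b} = t"
      by (simp_all only: enumerate_image_card fin)
    ultimately show ?thesis
      by blast
  qed
  moreover have "strict_mono (\<lambda>i. l (2 * i + 1))"
    using l(1) by (simp add: strict_mono_def)
  then have "infinite L"
    unfolding L_def by (intro range_inj_infinite strict_mono_on_imp_inj_on)
  ultimately show thesis
    using that[OF L_N] by blast
qed

text \<open>The terms of even and of odd index of an infinite set are interleaved, hence so are their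
  nonempty initial segments in \<open>F\<close>.\<close>

lemma exists_plegma_pair:
  assumes F: "regular_thin F" "F \<noteq> {}" "F \<noteq> {{}}" and L: "L \<subseteq> \<nat>\<^sub>+" "infinite L"
  obtains s t where "s \<in> F \<restriction>\<^sub>f L" "t \<in> F \<restriction>\<^sub>f L" "plegma s t"
proof -
  obtain N where N: "N \<subseteq> L" "infinite N" "very_large F N"
    using exists_very_large[OF F(1,2) L(2)] .
  obtain l :: "nat \<Rightarrow> nat" where l: "strict_mono l" "\<And>n. l n \<in> N"
    using infinite_enumerate[OF N(2)] by blast
  have "{} \<notin> F"
  proof
    assume "{} \<in> F"
    then have "s = {}" if "s \<in> F" for s
      using F(1) that unfolding regular_thin_def thin_def proper_initial_seg_def initial_seg_def
      by blast
    then show False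
      using F(2,3) by blast
  qed
  define p q where "p k = l (2 * k)" and "q k = l (2 * k + 1)" for k
  have pq: "interleaved p q" "range p \<subseteq> N" "range q \<subseteq> N"
    using l by (auto simp: interleaved_def p_def q_def strict_mono_less)
  obtain m n where mn: "p ` {..<m} \<in> F" "q ` {..<n} \<in> F"
    using N(3) pq interleaved_strict_mono[OF pq(1)] unfolding very_large_def by metis
  have "0 < m" "0 < n"
    using mn \<open>{} \<notin> F\<close> by (auto intro: gr0I)
  moreover have "range p \<subseteq> \<nat>\<^sub>+" "range q \<subseteq> \<nat>\<^sub>+"
    using pq N(1) L(1) by auto
  ultimately have "plegma (p ` {..<m}) (q ` {..<n})"
    using pq(1) by (intro plegma_interleaved)
  moreover have "p ` {..<m} \<in> F \<restriction>\<^sub>f L" "q ` {..<n} \<in> F \<restriction>\<^sub>f L"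
    using mn pq N(1) by (auto simp: restr_family_def Fpow_def)
  ultimately show thesis
    using that by blast
qed

section \<open>Maps that reverse or preserve all plegma pairs\<close>

text \<open>The sequences \<open>k \<mapsto> l (n + 2 * k)\<close>, for \<open>n = 0, 1, \<dots>\<close>, are consecutively
  interleaved, so the first elements of the images would form an infinite descending sequence.\<close>

lemma not_plegma_reversing:
  assumes L: "infinite L"
  shows "\<not> (\<forall>p q. interleaved p q \<and> range p \<subseteq> L \<and> range q \<subseteq> L \<longrightarrow>
    plegma (\<phi> (first_in F q)) (\<phi> (first_in F p)))"
proof
  assume H: "\<forall>p q. interleaved p q \<and> range p \<subseteq> L \<and> range q \<subseteq> L \<longrightarrow>
    plegma (\<phi> (first_in F q)) (\<phi> (first_in F p))"
  obtain l :: "nat \<Rightarrow> nat" where l: "strict_mono l" "\<And>n. l n \<in> L"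
    using infinite_enumerate[OF L] by blast
  define a where "a n = enumerate (\<phi> (first_in F (\<lambda>k. l (n + 2 * k)))) 0" for n
  have "a (Suc n) < a n" for n
  proof -
    have "interleaved (\<lambda>k. l (n + 2 * k)) (\<lambda>k. l (Suc n + 2 * k))"
      using l(1) by (simp add: interleaved_def strict_mono_less)
    then have "plegma (\<phi> (first_in F (\<lambda>k. l (Suc n + 2 * k)))) (\<phi> (first_in F (\<lambda>k. l (n + 2 * k))))"
      using H l(2) by blast
    then show ?thesis
      unfolding a_def by (intro plegma_less) (auto simp: plegma_def Fpow_def card_gt_0_iff)
  qed
  note descent = this
  have "a n + n \<le> a 0" for n
  proof (induction n)
    case (Suc n)
    then show ?case
      using descent[of n] by linarith
  qed simp
  from this[of "Suc (a 0)"] show False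
    by simp
qed

text \<open>The sequences \<open>k \<mapsto> p k - 1\<close> and \<open>p\<close> are interleaved if \<open>p\<close> is positive with gaps at
  least two, and so are \<open>p\<close> and \<open>k \<mapsto> p (k + 1) - 1\<close>; both operations keep the gaps. The former bounds the first
  element of the image from below by \<open>p 0\<close>, the latter carries this over to the \<open>k\<close>-th element.
  Doubling the elements of a set produces the gaps.\<close>

lemma plegma_preserving_hat_embedding:
  assumes F: "regular_thin F" and G: "regular_thin G"
    and L: "very_large F L" "infinite L"
    and maps: "\<And>s. s \<in> F \<Longrightarrow> s \<subseteq> L \<Longrightarrow> \<phi> s \<in> G"
    and pres: "\<And>p q. interleaved p q \<Longrightarrow> range p \<subseteq> L \<Longrightarrow> range q \<subseteq> L \<Longrightarrow>
      plegma (\<phi> (first_in F p)) (\<phi> (first_in F q))"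
  obtains h :: "nat \<Rightarrow> nat" where "strict_mono h" "\<And>u. u \<in> hat G \<Longrightarrow> h ` u \<in> hat F"
proof -
  obtain l :: "nat \<Rightarrow> nat" where l: "strict_mono l" "\<And>n. l n \<in> L"
    using infinite_enumerate[OF L(2)] by blast
  have thin: "thin F"
    using F by (simp add: regular_thin_def)
  define img where "img p = \<phi> (first_in F (\<lambda>k. l (p k)))" for p
  define gap where "gap p \<longleftrightarrow> (\<forall>k. p k + 2 \<le> p (Suc k))" for p :: "nat \<Rightarrow> nat"
  have gap_mono: "strict_mono p" if "gap p" for p
    unfolding strict_mono_Suc_iff
  proof
    fix k
    have "p k + 2 \<le> p (Suc k)"
      using that by (simp add: gap_def)
    then show "p k < p (Suc k)"
      by simp
  qed
  have init: "\<exists>n. first_in F (\<lambda>k. l (p k)) = (\<lambda>k. l (p k)) ` {..<n} \<and> (\<lambda>k. l (p k)) ` {..<n} \<in> F"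
    if "strict_mono p" for p
    using first_in_very_large[OF L(1) thin, of "\<lambda>k. l (p k)"] that l
    by (metis image_subsetI strict_mono_compose strict_mono_def)
  have img_G: "img p \<in> G" if p: "strict_mono p" for p
    using init[OF p] maps l(2) unfolding img_def by (metis image_subsetI)
  have pl: "plegma (img p) (img q)" "card (img p) \<le> card (img q)" "0 < card (img p)" "0 < card (img q)"
    if pq: "interleaved p q" for p q
  proof -
    have "interleaved (\<lambda>k. l (p k)) (\<lambda>k. l (q k))"
      using pq l(1) by (simp add: interleaved_def strict_mono_less)
    then show p: "plegma (img p) (img q)"
      unfolding img_def using l(2) by (intro pres) auto
    show "card (img p) \<le> card (img q)"
      using interleaved_strict_mono[OF pq] by (intro plegma_card_le[OF G] img_G p) auto
    show "0 < card (img p)" "0 < card (img q)"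
      using p by (auto simp: plegma_def Fpow_def card_gt_0_iff)
  qed
  have first: "p 0 \<le> enumerate (img p) 0" if "gap p" for p
    using that
  proof (induction "p 0" arbitrary: p)
    case 0
    then show ?case
      by simp
  next
    case (Suc n)
    let ?p = "\<lambda>k. p k - 1"
    have gap: "p k + 2 \<le> p (Suc k)" for k
      using Suc.prems by (simp add: gap_def)
    have pos: "1 \<le> p k" for k
      using strict_mono_leD[OF gap_mono[OF Suc.prems], of 0 k] Suc.hyps(2) by simp
    have "p k - 1 + 2 \<le> p (Suc k) - 1" for k
      using gap[of k] pos[of k] by simp
    then have "gap ?p"
      by (simp add: gap_def)
    then have "n \<le> enumerate (img ?p) 0"
      using Suc.hyps(1)[of ?p] Suc.hyps(2) by (metis diff_Suc_1)
    have "p k - 1 < p k \<and> p k < p (Suc k) - 1" for k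
      using gap[of k] pos[of k] by simp
    then have il: "interleaved ?p p"
      by (simp add: interleaved_def)
    have "enumerate (img ?p) 0 < enumerate (img p) 0"
      using pl[OF il] by (intro plegma_less) auto
    then show ?case
      using \<open>n \<le> enumerate (img ?p) 0\<close> Suc.hyps(2) by simp
  qed
  have dominates: "p k \<le> enumerate (img p) k" if "gap p" "k < card (img p)" for p k
    using that
  proof (induction k arbitrary: p)
    case 0
    then show ?case
      using first by simp
  next
    case (Suc k)
    let ?p = "\<lambda>i. p (Suc i) - 1"
    have gap: "p i + 2 \<le> p (Suc i)" for i
      using Suc.prems by (simp add: gap_def)
    have "p (Suc i) - 1 + 2 \<le> p (Suc (Suc i)) - 1" for i
      using gap[of i] gap[of "Suc i"] by simp
    then have "gap ?p"
      by (simp add: gap_def)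
    have "p i < p (Suc i) - 1 \<and> p (Suc i) - 1 < p (Suc i)" for i
      using gap[of i] by simp
    then have il: "interleaved p ?p"
      by (simp add: interleaved_def)
    have "p (Suc k) - 1 \<le> enumerate (img ?p) k"
      using Suc.IH[OF \<open>gap ?p\<close>] Suc.prems(2) pl(2)[OF il] by simp
    also have "\<dots> < enumerate (img p) (Suc k)"
      using Suc.prems(2) pl(2)[OF il] by (intro plegma_less_Suc[OF pl(1)[OF il]]) auto
    finally show ?case
      by simp
  qed
  have "(\<lambda>n. l (2 * n)) ` u \<in> hat F" if u: "u \<in> hat G" for u
  proof -
    have fin: "finite u"
      using finite_hat[OF G u] .
    obtain U where U: "strict_mono U" "\<And>k. k < card u \<Longrightarrow> U k = enumerate u k"
      using extend_strict_mono_on[OF strict_mono_on_enumerate[OF fin order_refl]] by metis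
    have u_eq: "U ` {..<card u} = u"
      using enumerate_image_card[OF fin] U(2) by auto
    have dbl: "gap (\<lambda>k. 2 * V k)" "strict_mono (\<lambda>k. 2 * V k)" if V: "strict_mono V" for V
    proof -
      have "V k < V (Suc k)" for k
        using V by (simp add: strict_mono_Suc_iff)
      then show "gap (\<lambda>k. 2 * V k)"
        unfolding gap_def by (metis Suc_leI add.commute add_2_eq_Suc mult_Suc_right mult_le_mono2 numeral_2_eq_2)
      then show "strict_mono (\<lambda>k. 2 * V k)"
        by (rule gap_mono)
    qed
    let ?x = "\<lambda>k. l (2 * U k)"
    obtain j where j: "first_in F ?x = ?x ` {..<j}" "?x ` {..<j} \<in> F"
      using init[OF dbl(2)[OF U(1)]] by blast
    have "card u \<le> j"
    proof (rule ccontr)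
      assume "\<not> card u \<le> j"
      let ?v = "\<phi> (?x ` {..<j})"
      \<comment> \<open>Only the first \<open>j\<close> terms of \<open>U\<close> determine the image \<open>?v\<close>, so the others may be
        replaced by terms too large to be bounded by elements of \<open>?v\<close>.\<close>
      obtain V where V: "strict_mono V" "\<And>k. k < j \<Longrightarrow> V k = U k"
          "\<And>k. j \<le> k \<Longrightarrow> Suc (enumerate ?v j) \<le> V k"
        by (rule extend_strict_mono_on[where n = j and b = "Suc (enumerate ?v j)",
              OF strict_mono_imp_strict_mono_on[OF U(1)]]) blast
      let ?y = "\<lambda>k. l (2 * V k)"
      have y: "strict_mono ?y"
        using dbl(2)[OF V(1)] l(1) by (simp add: strict_mono_def)
      have "?y ` {..<j} = ?x ` {..<j}"
        using V(2) by (intro image_cong) auto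
      then have img_V: "img (\<lambda>k. 2 * V k) = ?v"
        using first_in_eq[OF thin y, of j] j(2) by (simp add: img_def)
      have dom: "2 * V k \<le> enumerate ?v k" if "k < card ?v" for k
        using dominates[OF dbl(1)[OF V(1)], of k] that by (simp add: img_V)
      have card: "card ?v \<le> j"
        using dom[of j] V(3)[of j] by (cases "j < card ?v") auto
      have "enumerate u k \<le> enumerate ?v k" if "k < card ?v" for k
        using dom[OF that] V(2)[of k] U(2)[of k] that card \<open>\<not> card u \<le> j\<close> by simp
      then show False
        using no_shorter_above[OF G u, of ?v] img_G[OF dbl(2)[OF V(1)]] img_V card
          \<open>\<not> card u \<le> j\<close> by simp
    qed
    then have "(\<lambda>n. l (2 * n)) ` u \<subseteq> ?x ` {..<j}"
      by (subst u_eq[symmetric]) auto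
    then show ?thesis
      using j(2) subset_hat[OF F] hat_hereditary[OF F] by blast
  qed
  moreover have "strict_mono (\<lambda>n. l (2 * n))"
    using l(1) by (simp add: strict_mono_def)
  ultimately show thesis
    using that by blast
qed

section \<open>Comparing orders along an embedding\<close>

lemma initial_seg_image:
  fixes h :: "nat \<Rightarrow> nat"
  assumes h: "strict_mono h" and "s \<sqsubset>\<^sub>i t"
  shows "h ` s \<sqsubset>\<^sub>i h ` t"
proof -
  have inj: "inj h"
    using h by (rule strict_mono_on_imp_inj_on)
  have "s \<subseteq> t" "s \<noteq> t" and less: "\<And>a b. a \<in> s \<Longrightarrow> b \<in> t - s \<Longrightarrow> a < b"
    using assms(2) by (auto simp: proper_initial_seg_def initial_seg_def)
  moreover have "h a < h b" if "a \<in> s" "b \<in> t - s" for a b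
    using strict_monoD[OF h less[OF that]] .
  ultimately show ?thesis
    unfolding proper_initial_seg_def initial_seg_def
    by (simp add: inj_image_eq_iff[OF inj] image_mono flip: image_set_diff[OF inj])
qed

lemma ord_suc_mono: "a \<le> b \<Longrightarrow> ord_suc a \<le> ord_suc b"
  by (meson le_less_trans less_ord_suc ord_suc_le_iff)

lemma wf_extension:
  "\<not> has_infinite_chain T \<Longrightarrow> wf {(t, s). s \<in> T \<and> t \<in> T \<and> s \<sqsubset>\<^sub>i t}"
  unfolding wf_iff_no_infinite_down_chain has_infinite_chain_def by auto

text \<open>By induction along the closure of \<open>G\<close>, the rank of \<open>u\<close> is at most the rank of \<open>h ` u\<close>:
  every proper extension of \<open>u\<close> is mapped to a proper extension of \<open>h ` u\<close>.\<close>

lemma family_order_le_of_embedding: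
  assumes F: "regular_thin F" and G: "regular_thin G" and "G \<noteq> {}"
    and h: "strict_mono (h :: nat \<Rightarrow> nat)" "\<And>u. u \<in> hat G \<Longrightarrow> h ` u \<in> hat F"
  shows "family_order G \<le> family_order F"
proof -
  have rank: "node_order (hat G) s \<le> node_order (hat F) (h ` s)" if "s \<in> hat G" for s
    using wf_extension[OF no_infinite_chain[OF G]] that
  proof (induction s rule: wf_induct_rule)
    case (less s)
    define A where "A = {ord_suc (node_order (hat G) t) |t. t \<in> hat G \<and> s \<sqsubset>\<^sub>i t}"
    define B where "B = {ord_suc (node_order (hat F) t) |t. t \<in> hat F \<and> h ` s \<sqsubset>\<^sub>i t}"
    have bdd: "bdd_above B"
      unfolding B_def by (rule bdd_above_node_order[OF hat_subset_Fpow[OF F]])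
    have "a \<le> Sup B" if a: "a \<in> A" for a
    proof -
      obtain t where t: "t \<in> hat G" "s \<sqsubset>\<^sub>i t" "a = ord_suc (node_order (hat G) t)"
        using a unfolding A_def by blast
      have "a \<le> ord_suc (node_order (hat F) (h ` t))"
        using less t by (simp add: ord_suc_mono)
      moreover have "ord_suc (node_order (hat F) (h ` t)) \<in> B"
        using h(2)[OF t(1)] initial_seg_image[OF h(1) t(2)] unfolding B_def by blast
      ultimately show ?thesis
        using cSup_upper[OF _ bdd] by (meson order_trans)
    qed
    then have "Sup A \<le> Sup B"
      by (cases "A = {}") (auto simp: Sup_ordinal_empty intro: cSup_least)
    then show ?case
      using node_order_rec[OF no_infinite_chain[OF G] less.prems]
        node_order_rec[OF no_infinite_chain[OF F] h(2)[OF less.prems]]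
      unfolding A_def B_def by simp
  qed
  from rank[of "{}"] show ?thesis
    using empty_in_hat[OF G \<open>G \<noteq> {}\<close>] no_infinite_chain[OF F] no_infinite_chain[OF G]
    by (simp add: family_order_def)
qed

section \<open>Nonexistence of plegma preserving maps\<close>

theorem theorem3p18:
  fixes F G :: "nat set set" and M :: "nat set"
  assumes "regular_thin F" and "regular_thin G"
    and "F \<noteq> {}" and "G \<noteq> {}"
    and "family_order F < family_order G"
    and "M \<subseteq> \<nat>\<^sub>+" and "infinite M"
  shows "(F \<noteq> {{}} \<longrightarrow> \<not> (\<exists>\<phi> \<in> F \<restriction>\<^sub>f M \<rightarrow> G. plegma_preserving_on (F \<restriction>\<^sub>f M) \<phi>)) \<and>
    (\<forall>\<phi> \<in> F \<restriction>\<^sub>f M \<rightarrow> G. \<exists>L. L \<subseteq> M \<and> infinite L \<and>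
      (\<forall>s1 \<in> F \<restriction>\<^sub>f L. \<forall>s2 \<in> F \<restriction>\<^sub>f L. plegma s1 s2 \<longrightarrow>
        \<not> plegma (\<phi> s1) (\<phi> s2) \<and> \<not> plegma (\<phi> s2) (\<phi> s1)))"
proof -
  have thin: "thin F"
    using assms(1) by (simp add: regular_thin_def)
  have main: "\<exists>L. L \<subseteq> M \<and> infinite L \<and>
      (\<forall>s1 \<in> F \<restriction>\<^sub>f L. \<forall>s2 \<in> F \<restriction>\<^sub>f L. plegma s1 s2 \<longrightarrow>
        \<not> plegma (\<phi> s1) (\<phi> s2) \<and> \<not> plegma (\<phi> s2) (\<phi> s1))"
    if phi: "\<phi> \<in> F \<restriction>\<^sub>f M \<rightarrow> G" for \<phi>
  proof -
    obtain M0 where M0: "M0 \<subseteq> M" "infinite M0" "very_large F M0"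
      using exists_very_large[OF assms(1,3,7)] .
    obtain L1 c1 where L1: "L1 \<subseteq> M0" "infinite L1" and c1: "\<And>p q. interleaved p q \<Longrightarrow>
        range p \<subseteq> L1 \<Longrightarrow> range q \<subseteq> L1 \<Longrightarrow> plegma (\<phi> (first_in F p)) (\<phi> (first_in F q)) = c1"
      using interleaved_Ramsey[OF thin M0(3,2), of "\<lambda>s t. plegma (\<phi> s) (\<phi> t)"] by blast
    obtain L2 c2 where L2: "L2 \<subseteq> L1" "infinite L2" and c2: "\<And>p q. interleaved p q \<Longrightarrow>
        range p \<subseteq> L2 \<Longrightarrow> range q \<subseteq> L2 \<Longrightarrow> plegma (\<phi> (first_in F q)) (\<phi> (first_in F p)) = c2"
      using interleaved_Ramsey[OF thin very_large_subset[OF M0(3) L1(1)] L1(2),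
          of "\<lambda>s t. plegma (\<phi> t) (\<phi> s)"] by blast
    have "\<not> c1"
    proof
      assume c1
      have "\<phi> s \<in> G" if "s \<in> F" "s \<subseteq> L1" for s
      proof -
        have "s \<in> F \<restriction>\<^sub>f M"
          using that L1(1) M0(1) assms(1) by (auto simp: restr_family_def regular_thin_def Fpow_def)
        then show ?thesis
          using phi by blast
      qed
      then obtain h :: "nat \<Rightarrow> nat" where "strict_mono h" "\<And>u. u \<in> hat G \<Longrightarrow> h ` u \<in> hat F"
        using plegma_preserving_hat_embedding[OF assms(1,2) very_large_subset[OF M0(3) L1(1)] L1(2)]
          c1 \<open>c1\<close> by metis
      then have "family_order G \<le> family_order F"
        by (rule family_order_le_of_embedding[OF assms(1,2,4)])
      then show False
        using assms(5) by simp
    qed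
    have "\<not> c2"
      using not_plegma_reversing[OF L2(2), of \<phi> F] c2 by blast
    obtain L where L: "L \<subseteq> L2" "infinite L" and ext: "\<And>s t. s \<subseteq> L \<Longrightarrow> t \<subseteq> L \<Longrightarrow> plegma s t \<Longrightarrow>
        card s \<le> card t \<Longrightarrow> \<exists>p q. interleaved p q \<and> range p \<subseteq> L2 \<and> range q \<subseteq> L2 \<and>
          p ` {..<card s} = s \<and> q ` {..<card t} = t"
      using plegma_pairs_extend_to_interleaved[OF L2(2)] by metis
    have "\<not> plegma (\<phi> s) (\<phi> t) \<and> \<not> plegma (\<phi> t) (\<phi> s)"
      if st: "s \<in> F \<restriction>\<^sub>f L" "t \<in> F \<restriction>\<^sub>f L" "plegma s t" for s t
    proof -
      have in_F: "s \<in> F" "t \<in> F" "s \<subseteq> L" "t \<subseteq> L"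
        using st by (auto simp: restr_family_def Fpow_def)
      obtain p q where pq: "interleaved p q" "range p \<subseteq> L2" "range q \<subseteq> L2"
          "p ` {..<card s} = s" "q ` {..<card t} = t"
        using ext[OF in_F(3,4) st(3) plegma_card_le[OF assms(1) in_F(1,2) st(3)]] by blast
      have "first_in F p = s" "first_in F q = t"
        using first_in_eq[OF thin, of p "card s"] first_in_eq[OF thin, of q "card t"]
          interleaved_strict_mono[OF pq(1)] pq(4,5) in_F by simp_all
      then show ?thesis
        using c1[of p q] c2[of p q] pq(1,2,3) L2(1) \<open>\<not> c1\<close> \<open>\<not> c2\<close> by auto
    qed
    moreover have "L \<subseteq> M"
      using L(1) L2(1) L1(1) M0(1) by blast
    ultimately show ?thesis
      using L(2) by blast
  qed
  have "\<not> plegma_preserving_on (F \<restriction>\<^sub>f M) \<phi>" if nontrivial: "F \<noteq> {{}}" and phi: "\<phi> \<in> F \<restriction>\<^sub>f M \<rightarrow> G" for \<phi>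
  proof
    assume pres: "plegma_preserving_on (F \<restriction>\<^sub>f M) \<phi>"
    obtain L where L: "L \<subseteq> M" "infinite L" "\<forall>s1 \<in> F \<restriction>\<^sub>f L. \<forall>s2 \<in> F \<restriction>\<^sub>f L. plegma s1 s2 \<longrightarrow>
        \<not> plegma (\<phi> s1) (\<phi> s2) \<and> \<not> plegma (\<phi> s2) (\<phi> s1)"
      using main[OF phi] by blast
    have "L \<subseteq> \<nat>\<^sub>+"
      using L(1) assms(6) by blast
    then obtain s t where st: "s \<in> F \<restriction>\<^sub>f L" "t \<in> F \<restriction>\<^sub>f L" "plegma s t"
      using exists_plegma_pair[OF assms(1,3) nontrivial _ L(2)] by metis
    moreover have "s \<in> F \<restriction>\<^sub>f M" "t \<in> F \<restriction>\<^sub>f M"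
      using st L(1) by (auto simp: restr_family_def Fpow_def)
    ultimately show False
      using L(3) pres unfolding plegma_preserving_on_def by blast
  qed
  then show ?thesis
    using main by blast
qed

end
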